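(* Let $(y_n)_{n\in\mathbb{N}}$ be a nonincreasing sequence of positive real numbers with $\sum_{n=1}^\infty y_n<\infty$ such that $E(y_n)$ is a Cantorval. Then there exists a nonincreasing sequence $(x_n)_{n\in\mathbb{N}}$ of positive real numbers with $\sum_{n=1}^\infty x_n<\infty$ such that $E(x_n)$ is a Cantorval, $E(x_n)\supset E(y_n)$, and $E(x_n)$ has a $\mathfrak{c}$-point.
   Context: For a summable sequence $(x_n)$ of positive reals, $E(x_n)=\{\sum_{n\in A}x_n : A\subset\mathbb{N}\}$. A point $t\in E(x_n)$ is a $\mathfrak{c}$-point (with respect to $(x_n)$) if the family $\{A\subset\mathbb{N}:\sum_{n\in A}x_n=t\}$ has cardinality continuum. A Cantorval is a subset of $\mathbb{R}$ homeomorphic to $E(z_n)$ where $z_{2n-1}=\frac{3}{4^n}$, $z_{2n}=\frac{2}{4^n}$ for $n\in\mathbb{N}=\{1,2,\dots\}$. *)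

theory Defs
  imports "HOL-Analysis.Analysis"
begin

(* Sequences (x_n) indexed by {1,2,...} are represented as functions on nat with the index
   shifted by one: x k is x_(k+1). For a summable sequence of positive reals every subseries
   converges absolutely, so infsum x A is the sum of x_n over n in A for every A. *)

definition achievement_set :: "(nat \<Rightarrow> real) \<Rightarrow> real set" where
  "achievement_set x = range (infsum x)"

(* In the unshifted indexing: z_(2n-1) = 3/4^n and z_(2n) = 2/4^n for n >= 1. *)
definition guthrie_nymann :: "nat \<Rightarrow> real" where
  "guthrie_nymann k = (if even k then 3 else 2) / 4 ^ (k div 2 + 1)"

definition cantorval :: "real set \<Rightarrow> bool" where
  "cantorval S \<longleftrightarrow> S homeomorphic achievement_set guthrie_nymann"

definition continuum_point :: "(nat \<Rightarrow> real) \<Rightarrow> real \<Rightarrow> bool" where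
  "continuum_point x t \<longleftrightarrow>
     t \<in> achievement_set x \<and> {A. infsum x A = t} \<approx> (UNIV :: real set)"

end

theory Submission
  imports Defs
begin

text \<open>
  The idea is to repeat infinitely many terms of the sequence \<open>y\<close>, chosen very sparsely. Let \<open>x\<close> be
  the sequence in which every \<open>y n\<close> with \<open>n \<in> M\<close> occurs twice. If \<open>M\<close> is infinite, then the sum of
  \<open>y\<close> over \<open>M\<close> is a continuum point of \<open>x\<close>, because for each \<open>n \<in> M\<close> either of the two copies can be
  used; and the achievement set of \<open>x\<close> contains that of \<open>y\<close>. It remains to see that, for a suitable
  \<open>M\<close>, the achievement set of \<open>x\<close> is still a Cantorval.

  Call \<open>n\<close> a gap index of a sequence if its \<open>n\<close>-th term exceeds the sum of all later terms. A
  nonincreasing sequence with infinitely many gap indices has an achievement set with gaps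
  arbitrarily close to \<open>0\<close>. If in addition that set has an interior point, then its translated pieces
  show that it is the closure of its interior and that each endpoint of a gap is a limit of further
  gaps (\<open>cantorval_like\<close>; see \<open>cantorval_like_achievement_set\<close>). Any two such sets are homeomorphic
  (\<open>cantorval_like_homeomorphic\<close>), by a back-and-forth construction of an increasing bijection of
  the line that matches gaps with gaps and islands with islands. The Guthrie-Nymann set is of this
  kind: it contains \<open>[2/3, 1)\<close> because \<open>0, 2, 3, 5\<close> represent all residues modulo \<open>4\<close>.

  Conversely, a set homeomorphic to the Guthrie-Nymann set inherits a nondegenerate connected
  subset and a point whose component is a singleton. Hence the achievement set of \<open>y\<close> has interior,
  and by Kakeya's theorem \<open>y\<close> has infinitely many gap indices
  (\<open>cantorval_achievement_setD\<close>). Choosing \<open>M\<close> among the gap indices, so sparse that the repeated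
  terms after \<open>n \<in> M\<close> do not fill the surplus of \<open>y n\<close> over the later terms, keeps the last copy of
  each \<open>y n\<close> with \<open>n \<in> M\<close> a gap index of \<open>x\<close>. Interior is inherited from the achievement set of \<open>y\<close>.
\<close>

section \<open>Cantorval-like sets and their gaps and islands\<close>

text \<open>An intrinsic description of Cantorvals: compact, nonempty, with dense interior, and such that
  no endpoint of a gap is an endpoint of a nondegenerate component; the last two clauses say that
  the right and the left endpoint of a gap is approached by further gaps from the other side. The
  two unbounded components of the complement count as gaps.\<close>

definition cantorval_like :: "real set \<Rightarrow> bool" where
  "cantorval_like S \<longleftrightarrow> compact S \<and> S \<noteq> {} \<and> S \<subseteq> closure (interior S) \<and>
     (\<forall>p v e. v \<in> S \<and> p < v \<and> {p<..<v} \<inter> S = {} \<and> v < e \<longrightarrow> (\<exists>c. v < c \<and> c < e \<and> c \<notin> S)) \<and>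
     (\<forall>u q e. u \<in> S \<and> u < q \<and> {u<..<q} \<inter> S = {} \<and> e < u \<longrightarrow> (\<exists>c. e < c \<and> c < u \<and> c \<notin> S))"

text \<open>Two points are unseparated if they lie strictly on the same side of every frontier point. Off
  the frontier this is an equivalence relation, whose classes are the gaps (components of the
  complement) and the islands (components of the interior).\<close>

definition unseparated :: "real set \<Rightarrow> real \<Rightarrow> real \<Rightarrow> bool" where
  "unseparated S p q \<longleftrightarrow> (\<forall>z\<in>frontier S. z < p \<and> z < q \<or> p < z \<and> q < z)"

text \<open>A countable set of points that is dense in every gap and every island.\<close>

definition sample :: "real set \<Rightarrow> real set" where
  "sample S = \<rat> - frontier S"

lemma unseparated_refl: "p \<notin> frontier S \<Longrightarrow> unseparated S p p"
  unfolding unseparated_def by (metis linorder_neqE_linordered_idom)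

lemma unseparated_sym: "unseparated S p q \<Longrightarrow> unseparated S q p"
  unfolding unseparated_def by blast

lemma unseparated_trans: "unseparated S p q \<Longrightarrow> unseparated S q r \<Longrightarrow> unseparated S p r"
  unfolding unseparated_def by (meson order_less_asym)

lemma unseparated_between:
  assumes "unseparated S p q" "p \<le> c" "c \<le> q"
  shows "unseparated S p c" "unseparated S c q"
  using assms unfolding unseparated_def by force+

lemma unseparated_iff_segment:
  assumes "p \<le> q"
  shows "unseparated S p q \<longleftrightarrow> {p..q} \<inter> frontier S = {}"
proof
  assume "unseparated S p q"
  then show "{p..q} \<inter> frontier S = {}" unfolding unseparated_def by force
next
  assume *: "{p..q} \<inter> frontier S = {}"
  show "unseparated S p q"
    unfolding unseparated_def
  proof
    fix z assume "z \<in> frontier S"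
    then have "\<not> (p \<le> z \<and> z \<le> q)" using * by auto
    then show "z < p \<and> z < q \<or> p < z \<and> q < z" using assms by linarith
  qed
qed

lemma separated_if_crosses:
  assumes "p \<le> q" "p \<in> S \<longleftrightarrow> q \<notin> S"
  shows "\<not> unseparated S p q"
proof -
  have "{p..q} \<inter> S \<noteq> {}" "{p..q} - S \<noteq> {}"
    using assms by fastforce+
  then have "{p..q} \<inter> frontier S \<noteq> {}"
    by (intro connected_Int_frontier) auto
  then show ?thesis
    using assms(1) unseparated_iff_segment by blast
qed

lemma unseparated_mem_iff:
  assumes "unseparated S p q"
  shows "p \<in> S \<longleftrightarrow> q \<in> S"
  by (metis assms linorder_le_cases separated_if_crosses unseparated_sym)

lemma separated_if_point_between:
  assumes "p \<le> c" "c \<le> q" "p \<notin> S" "c \<in> S"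
  shows "\<not> unseparated S p q"
  using assms separated_if_crosses[of p c S] unseparated_between(1)[of S p q c] by blast

lemma ex_sample_in_open:
  assumes "closed S" "open U" "U \<noteq> {}"
  shows "\<exists>r \<in> sample S. r \<in> U"
proof -
  have "interior (frontier S) = {}"
    using assms(1) interior_subset[of "frontier S"] interior_mono[OF frontier_subset_closed[OF assms(1)]]
    by (auto simp: frontier_def)
  then have "\<not> U \<subseteq> frontier S"
    using assms by (metis interior_maximal subset_empty)
  then obtain u where "u \<in> U - frontier S" by blast
  moreover have "open (U - frontier S)"
    using assms by (simp add: open_Diff)
  ultimately obtain e where e: "e > 0" "ball u e \<subseteq> U - frontier S"
    by (meson open_contains_ball)
  obtain r where "r \<in> \<rat>" "u < r" "r < u + e"
    using Rats_dense_in_real[of u "u + e"] e(1) by auto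
  then have "r \<in> ball u e" by (auto simp: dist_real_def)
  then show ?thesis
    using e(2) \<open>r \<in> \<rat>\<close> unfolding sample_def by blast
qed

lemma ex_right_end_of_gap:
  fixes p :: real
  assumes "closed S" "p \<notin> S" "z \<in> S" "p < z"
  obtains v where "v \<in> S" "p < v" "v \<le> z" "{p<..<v} \<inter> S = {}"
proof -
  let ?K = "S \<inter> {p..z}"
  have "compact ?K" "?K \<noteq> {}"
    using assms by (auto simp: closed_Int_compact)
  then obtain v where v: "v \<in> ?K" "\<forall>t\<in>?K. v \<le> t"
    using compact_attains_inf by metis
  moreover have "v \<noteq> p" using v assms by auto
  ultimately have "p < v" by auto
  moreover have "{p<..<v} \<inter> S = {}"
  proof (rule ccontr)
    assume "{p<..<v} \<inter> S \<noteq> {}"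
    then obtain t where "t \<in> S" "p < t" "t < v" by auto
    then show False using v by (metis IntD2 IntI atLeastAtMost_iff less_imp_le linorder_not_le order_trans)
  qed
  ultimately show ?thesis using that v by auto
qed

lemma ex_left_end_of_gap:
  fixes q :: real
  assumes "closed S" "q \<notin> S" "z \<in> S" "z < q"
  obtains u where "u \<in> S" "u < q" "z \<le> u" "{u<..<q} \<inter> S = {}"
proof -
  let ?K = "S \<inter> {z..q}"
  have "compact ?K" "?K \<noteq> {}"
    using assms by (auto simp: closed_Int_compact)
  then obtain v where v: "v \<in> ?K" "\<forall>t\<in>?K. t \<le> v"
    using compact_attains_sup by metis
  moreover have "v \<noteq> q" using v assms by auto
  ultimately have "v < q" by auto
  moreover have "{v<..<q} \<inter> S = {}"
  proof (rule ccontr)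
    assume "{v<..<q} \<inter> S \<noteq> {}"
    then obtain t where "t \<in> S" "v < t" "t < q" by auto
    then show False using v by (metis IntD2 IntI atLeastAtMost_iff less_imp_le linorder_not_le order_trans)
  qed
  ultimately show ?thesis using that v by auto
qed

lemma ex_interior_near:
  fixes l u v :: real
  assumes "S \<subseteq> closure (interior S)" "v \<in> S" "l < v" "v < u"
  shows "\<exists>c \<in> interior S. l < c \<and> c < u"
proof -
  have "v \<in> closure (interior S)" "v \<in> {l<..<u}" using assms by auto
  then have "interior S \<inter> {l<..<u} \<noteq> {}"
    by (metis IntI closure_iff_nhds_not_empty inf_commute open_greaterThanLessThan order_refl)
  then show ?thesis by auto
qed

text \<open>Between different gaps or islands there is a further gap.\<close>

lemma ex_gap_point_between:
  assumes C: "cantorval_like S" and pq: "p < q" and F: "p \<notin> frontier S" "q \<notin> frontier S"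
    and sep: "\<not> unseparated S p q"
  shows "\<exists>c. p < c \<and> c < q \<and> c \<notin> S \<and> \<not> unseparated S p c \<and> \<not> unseparated S c q"
proof -
  have cl: "closed S" and reg: "S \<subseteq> closure (interior S)"
    using C unfolding cantorval_like_def by (auto simp: compact_imp_closed)
  have right: "\<exists>c. v < c \<and> c < e \<and> c \<notin> S" if "v \<in> S" "p < v" "{p<..<v} \<inter> S = {}" "v < e" for p v e
    using C that unfolding cantorval_like_def by blast
  have left: "\<exists>c. e < c \<and> c < u \<and> c \<notin> S" if "u \<in> S" "u < q" "{u<..<q} \<inter> S = {}" "e < u" for u q e
    using C that unfolding cantorval_like_def by blast
  obtain z where z: "z \<in> frontier S" "p < z" "z < q"
    using sep F pq unseparated_iff_segment[of p q S] by (force simp: less_le)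
  have zS: "z \<in> S" using z(1) cl frontier_subset_closed by blast
  show ?thesis
  proof (cases "p \<in> S")
    case pS: True
    show ?thesis
    proof (cases "q \<in> S")
      case True
      have "z \<in> closure (- S)" using z(1) by (simp add: frontier_closures)
      then have "- S \<inter> {p<..<q} \<noteq> {}"
        by (metis IntI closure_iff_nhds_not_empty greaterThanLessThan_iff inf_commute
            open_greaterThanLessThan order_refl z(2,3))
      then obtain c where "c \<notin> S" "p < c" "c < q" by auto
      then show ?thesis
        using pS True by (metis less_imp_le separated_if_crosses)
    next
      case False
      obtain u where u: "u \<in> S" "u < q" "z \<le> u" "{u<..<q} \<inter> S = {}"
        using ex_left_end_of_gap[OF cl False zS z(3)] .
      obtain c where c: "p < c" "c < u" "c \<notin> S" using left[of u q p] u z by auto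
      then have "\<not> unseparated S c q"
        using u separated_if_point_between[of c u q S] by auto
      then show ?thesis
        using pS c u by (metis less_imp_le less_trans separated_if_crosses)
    qed
  next
    case pS: False
    obtain v where v: "v \<in> S" "p < v" "v \<le> z" "{p<..<v} \<inter> S = {}"
      using ex_right_end_of_gap[OF cl pS zS z(2)] .
    show ?thesis
    proof (cases "q \<in> S")
      case True
      obtain c where c: "v < c" "c < q" "c \<notin> S" using right[of v p q] v z by auto
      then have "\<not> unseparated S p c"
        using v pS separated_if_point_between[of p v c S] by auto
      then show ?thesis
        using True c v by (metis less_imp_le less_trans separated_if_crosses)
    next
      case False
      \<comment> \<open>The piece of \<open>S\<close> between the gaps is no single point: it contains \<open>v\<close> and the larger \<open>w'\<close>.\<close>
      obtain w where w: "w \<in> interior S" "p < w" "w < q"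
        using ex_interior_near[OF reg v(1,2), of q] v z by auto
      obtain e where e: "e > 0" "ball w e \<subseteq> S" using w(1) by (auto simp: mem_interior)
      define w' where "w' = (w + min (w + e) q) / 2"
      have w': "w < w'" "w' < q" "w' < w + e" unfolding w'_def using e w by auto
      then have "w' \<in> ball w e" by (auto simp: dist_real_def)
      then have w'S: "w' \<in> S" using e by auto
      have "w \<in> S" using w(1) interior_subset by blast
      have "v \<le> w" using v(4) \<open>w \<in> S\<close> w(2) by (metis disjoint_iff greaterThanLessThan_iff not_le)
      then obtain c where c: "v < c" "c < w'" "c \<notin> S" using right[of v p w'] v w' by auto
      have "\<not> unseparated S p c" using separated_if_point_between[of p v c S] v c pS by auto
      moreover have "\<not> unseparated S c q" using separated_if_point_between[of c w' q S] c w' w'S by auto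
      ultimately show ?thesis using c v w' by (meson less_trans)
    qed
  qed
qed

text \<open>Between different gaps or islands there is both a further gap (\<open>k\<close> false) and a further
  island (\<open>k\<close> true): take two intermediate gaps and an interior point near a point of \<open>S\<close> that
  separates them.\<close>

lemma ex_sample_between:
  assumes C: "cantorval_like S" and pq: "p < q" and F: "p \<notin> frontier S" "q \<notin> frontier S"
    and sep: "\<not> unseparated S p q"
  shows "\<exists>c \<in> sample S. p < c \<and> c < q \<and> (c \<in> S \<longleftrightarrow> k) \<and> \<not> unseparated S p c \<and> \<not> unseparated S c q"
proof -
  have cl: "closed S" and reg: "S \<subseteq> closure (interior S)"
    using C unfolding cantorval_like_def by (auto simp: compact_imp_closed)
  have notF: "c \<notin> frontier S" if "c \<notin> S" for c
    using that cl frontier_subset_closed by blast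
  obtain c1 where c1: "p < c1" "c1 < q" "c1 \<notin> S" "\<not> unseparated S p c1" "\<not> unseparated S c1 q"
    using ex_gap_point_between[OF assms] by blast
  obtain c2 where c2: "p < c2" "c2 < c1" "c2 \<notin> S" "\<not> unseparated S p c2" "\<not> unseparated S c2 c1"
    using ex_gap_point_between[OF C c1(1) F(1) notF[OF c1(3)] c1(4)] by blast
  have between: "\<not> unseparated S p c \<and> \<not> unseparated S c q" if "c2 \<le> c" "c \<le> c1" for c
    using that c1 c2 unseparated_between less_imp_le by metis
  show ?thesis
  proof (cases k)
    case True
    obtain z where z: "z \<in> frontier S" "c2 < z" "z < c1"
      using c2 notF[OF c2(3)] notF[OF c1(3)] unseparated_iff_segment[of c2 c1 S] by (force simp: less_le)
    have zS: "z \<in> S" using z(1) cl frontier_subset_closed by blast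
    obtain w where w: "w \<in> interior S" "c2 < w" "w < c1"
      using ex_interior_near[OF reg zS z(2,3)] by auto
    have "\<exists>r\<in>sample S. r \<in> interior S \<inter> {c2<..<c1}"
      by (rule ex_sample_in_open) (use cl w in auto)
    then obtain r where "r \<in> sample S" "r \<in> S" "c2 < r" "r < c1"
      using interior_subset by auto
    then show ?thesis using between[of r] c1 c2 True by (metis less_imp_le less_trans)
  next
    case False
    have "open (- S)" using cl by auto
    then obtain e where e: "e > 0" "ball c1 e \<subseteq> - S"
      using c1(3) by (meson ComplI open_contains_ball)
    have "\<exists>r\<in>sample S. r \<in> {max c2 (c1 - e)<..<c1}"
      by (rule ex_sample_in_open) (use cl e c2 in auto)
    then obtain r where r: "r \<in> sample S" "c2 < r" "c1 - e < r" "r < c1" by auto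
    then have "r \<in> ball c1 e" by (auto simp: dist_real_def)
    then have "r \<notin> S" using e by auto
    then show ?thesis using r between[of r] c1 c2 False by (metis less_imp_le less_trans)
  qed
qed

section \<open>Back-and-forth: cantorval-like sets are homeomorphic\<close>

text \<open>The finite approximations of an increasing bijection from \<open>sample S\<close> to \<open>sample T\<close> that respects
  membership and the partition into gaps and islands. Each of them relates a pair of points below,
  and a pair of points above, the two sets, so that the unbounded gaps are matched from the start.\<close>

definition partial_match :: "real set \<Rightarrow> real set \<Rightarrow> (real \<times> real) set \<Rightarrow> bool" where
  "partial_match S T f \<longleftrightarrow> finite f
     \<and> (\<forall>a b. (a, b) \<in> f \<longrightarrow> a \<in> sample S \<and> b \<in> sample T \<and> (a \<in> S \<longleftrightarrow> b \<in> T))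
     \<and> (\<forall>a b a' b'. (a, b) \<in> f \<and> (a', b') \<in> f \<longrightarrow>
           (a < a' \<longleftrightarrow> b < b') \<and> (unseparated S a a' \<longleftrightarrow> unseparated T b b'))
     \<and> (\<exists>a b. (a, b) \<in> f \<and> (\<forall>s\<in>S. a < s) \<and> (\<forall>t\<in>T. b < t))
     \<and> (\<exists>a b. (a, b) \<in> f \<and> (\<forall>s\<in>S. s < a) \<and> (\<forall>t\<in>T. t < b))"

lemma partial_matchD:
  assumes "partial_match S T f"
  shows "finite f"
    and "(a, b) \<in> f \<Longrightarrow> a \<in> sample S"
    and "(a, b) \<in> f \<Longrightarrow> b \<in> sample T"
    and "(a, b) \<in> f \<Longrightarrow> a \<in> S \<longleftrightarrow> b \<in> T"
    and "(a, b) \<in> f \<Longrightarrow> (a', b') \<in> f \<Longrightarrow> a < a' \<longleftrightarrow> b < b'"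
    and "(a, b) \<in> f \<Longrightarrow> (a', b') \<in> f \<Longrightarrow> unseparated S a a' \<longleftrightarrow> unseparated T b b'"
    and "\<exists>a b. (a, b) \<in> f \<and> (\<forall>s\<in>S. a < s) \<and> (\<forall>t\<in>T. b < t)"
    and "\<exists>a b. (a, b) \<in> f \<and> (\<forall>s\<in>S. s < a) \<and> (\<forall>t\<in>T. t < b)"
  using assms unfolding partial_match_def by - (elim conjE, (assumption | metis))+

lemma partial_match_converse:
  assumes "partial_match S T f"
  shows "partial_match T S (f\<inverse>)"
  using assms unfolding partial_match_def finite_converse converse_iff
  by (elim conjE, intro conjI) (assumption | metis)+

lemma ex_partial_match:
  assumes "compact S" "S \<noteq> {}" "compact T" "T \<noteq> {}"
  shows "\<exists>f. partial_match S T f"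
proof -
  have *: "\<exists>a b. a \<in> sample S \<and> b \<in> sample S \<and> (\<forall>s\<in>S. a < s \<and> s < b)" if S: "compact S" for S
  proof -
    have cl: "closed S" using S by (rule compact_imp_closed)
    obtain B where B: "\<And>s. s \<in> S \<Longrightarrow> \<bar>s\<bar> \<le> B"
      using compact_imp_bounded[OF S] unfolding bounded_iff real_norm_def by blast
    have "\<exists>r\<in>sample S. r \<in> {..<-B}" "\<exists>r\<in>sample S. r \<in> {B<..}"
      by (rule ex_sample_in_open; simp add: cl)+
    then obtain a b where "a \<in> sample S" "b \<in> sample S" "a < -B" "B < b" by auto
    moreover have "a < s \<and> s < b" if "s \<in> S" for s using B[OF that] calculation by auto
    ultimately show ?thesis by blast
  qed
  obtain a b where ab: "a \<in> sample S" "b \<in> sample S" "\<forall>s\<in>S. a < s \<and> s < b" using *[OF assms(1)] by blast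
  obtain c d where cd: "c \<in> sample T" "d \<in> sample T" "\<forall>s\<in>T. c < s \<and> s < d" using *[OF assms(3)] by blast
  obtain s t where st: "s \<in> S" "t \<in> T" using assms by blast
  then have "a < s" "s < b" "c < t" "t < d" using ab cd by auto
  then have "a < b" "c < d" by linarith+
  moreover have "a \<notin> S" "b \<notin> S" "c \<notin> T" "d \<notin> T" using ab cd by auto
  moreover have "\<not> unseparated S a b" "\<not> unseparated T c d"
    using st \<open>a \<notin> S\<close> \<open>c \<notin> T\<close> \<open>a < s\<close> \<open>s < b\<close> \<open>c < t\<close> \<open>t < d\<close>
      separated_if_point_between[of a s b S] separated_if_point_between[of c t d T] by auto
  moreover have "unseparated S a a" "unseparated S b b" "unseparated T c c" "unseparated T d d"
    using ab cd by (auto simp: sample_def intro: unseparated_refl)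
  ultimately have "partial_match S T {(a, c), (b, d)}"
    using ab cd unfolding partial_match_def
    by (auto dest: unseparated_sym)
  then show ?thesis by blast
qed

text \<open>The forth step. If the new point \<open>a\<close> is unseparated from a point already matched, its image is
  chosen in the corresponding gap or island of \<open>T\<close>. Otherwise \<open>a\<close> lies between two matched
  neighbours in different pieces, and its image is taken in a fresh gap or island between the images
  of these neighbours.\<close>

lemma partial_match_extend_domain:
  assumes clS: "closed S" and T: "cantorval_like T" and f: "partial_match S T f" and a: "a \<in> sample S"
  shows "\<exists>b. partial_match S T (insert (a, b) f)"
proof (cases "a \<in> Domain f")
  case True
  then show ?thesis using f by (metis DomainE insert_absorb)
next
  case new: False
  have clT: "closed T" using T by (simp add: cantorval_like_def compact_imp_closed)
  note fin = partial_matchD(1)[OF f] and mem = partial_matchD(2,3,4)[OF f]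
    and ord = partial_matchD(5)[OF f] and sim = partial_matchD(6)[OF f]
  have reflS: "unseparated S a a" using a by (auto simp: sample_def intro: unseparated_refl)
  have ne: "p \<noteq> a" if "(p, q) \<in> f" for p q using new that by blast
  have enough: ?thesis if b: "b \<in> sample T" "b \<in> T \<longleftrightarrow> a \<in> S"
    "\<And>p q. (p, q) \<in> f \<Longrightarrow> p < a \<Longrightarrow> q < b" "\<And>p q. (p, q) \<in> f \<Longrightarrow> a < p \<Longrightarrow> b < q"
    "\<And>p q. (p, q) \<in> f \<Longrightarrow> unseparated S p a \<longleftrightarrow> unseparated T q b" for b
  proof (intro exI[of _ b])
    have reflT: "unseparated T b b" using b(1) by (auto simp: sample_def intro: unseparated_refl)
    have "p < a \<longleftrightarrow> q < b" "a < p \<longleftrightarrow> b < q" if "(p, q) \<in> f" for p q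
      using b(3,4)[OF that] ne[OF that] by linarith+
    moreover have "unseparated S a p \<longleftrightarrow> unseparated T b q" if "(p, q) \<in> f" for p q
      using b(5)[OF that] unseparated_sym by blast
    ultimately have step: "(p < p' \<longleftrightarrow> q < q') \<and> (unseparated S p p' \<longleftrightarrow> unseparated T q q')"
      if "(p, q) \<in> insert (a, b) f" "(p', q') \<in> insert (a, b) f" for p q p' q'
      using that ord sim b(5) reflS reflT by auto
    have "p \<in> sample S \<and> q \<in> sample T \<and> (p \<in> S \<longleftrightarrow> q \<in> T)" if "(p, q) \<in> insert (a, b) f" for p q
      using that mem a b(1,2) by blast
    moreover have "\<exists>p q. (p, q) \<in> insert (a, b) f \<and> (\<forall>s\<in>S. p < s) \<and> (\<forall>t\<in>T. q < t)"
      "\<exists>p q. (p, q) \<in> insert (a, b) f \<and> (\<forall>s\<in>S. s < p) \<and> (\<forall>t\<in>T. t < q)"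
      using partial_matchD(7,8)[OF f] by blast+
    ultimately show "partial_match S T (insert (a, b) f)"
      using step fin unfolding partial_match_def by simp
  qed
  define L where "L = {(p, q) \<in> f. p < a}"
  define U where "U = {(p, q) \<in> f. a < p}"
  have finLU: "finite L" "finite U" using fin unfolding L_def U_def by (auto intro: finite_subset)
  have pred: "\<exists>p1 m. (p1, m) \<in> f \<and> p1 < a \<and> (\<forall>(p, q) \<in> f. p < a \<longrightarrow> p \<le> p1 \<and> q \<le> m)" if neL: "L \<noteq> {}"
  proof -
    obtain z where z: "z \<in> L" "\<forall>w\<in>L. fst w \<le> fst z"
    proof -
      have "Max (fst ` L) \<in> fst ` L" "finite (fst ` L)" using neL finLU by (auto intro!: Max_in)
      then obtain z where "z \<in> L" "fst z = Max (fst ` L)" by (metis imageE)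
      then show ?thesis using that finLU by auto
    qed
    obtain p1 m where zz: "z = (p1, m)" by fastforce
    have "(p1, m) \<in> f \<and> p1 < a"
      using z zz unfolding L_def by auto
    moreover have "p \<le> p1 \<and> q \<le> m" if "(p, q) \<in> f" "p < a" for p q
    proof -
      have "p \<le> p1" using z(2) that zz unfolding L_def by auto
      moreover have "(p1, m) \<in> f" using z zz unfolding L_def by auto
      ultimately show ?thesis using ord that by (metis linorder_not_le)
    qed
    ultimately show ?thesis by blast
  qed
  have succ: "\<exists>p2 M. (p2, M) \<in> f \<and> a < p2 \<and> (\<forall>(p, q) \<in> f. a < p \<longrightarrow> p2 \<le> p \<and> M \<le> q)" if neU: "U \<noteq> {}"
  proof -
    obtain z where z: "z \<in> U" "\<forall>w\<in>U. fst z \<le> fst w"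
    proof -
      have "Min (fst ` U) \<in> fst ` U" "finite (fst ` U)" using neU finLU by (auto intro!: Min_in)
      then obtain z where "z \<in> U" "fst z = Min (fst ` U)" by (metis imageE)
      then show ?thesis using that finLU by auto
    qed
    obtain p2 M where zz: "z = (p2, M)" by fastforce
    have "(p2, M) \<in> f \<and> a < p2"
      using z zz unfolding U_def by auto
    moreover have "p2 \<le> p \<and> M \<le> q" if "(p, q) \<in> f" "a < p" for p q
    proof -
      have "p2 \<le> p" using z(2) that zz unfolding U_def by auto
      moreover have "(p2, M) \<in> f" using z zz unfolding U_def by auto
      ultimately show ?thesis using ord that by (metis linorder_not_le)
    qed
    ultimately show ?thesis by blast
  qed
  show ?thesis
  proof (cases "\<exists>p q. (p, q) \<in> f \<and> unseparated S p a")
    case True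
    then obtain p q where pq: "(p, q) \<in> f" "unseparated S p a" by blast
    have near: "\<exists>e>0. \<forall>b. \<bar>b - c\<bar> < e \<longrightarrow> unseparated T c b" if "c \<in> sample T" for c
    proof -
      have "open (- frontier T)" "c \<in> - frontier T" using that by (auto simp: sample_def)
      then obtain e where e: "e > 0" "ball c e \<subseteq> - frontier T" by (meson open_contains_ball)
      have "unseparated T c b" if "\<bar>b - c\<bar> < e" for b
        unfolding unseparated_def
      proof
        fix z assume "z \<in> frontier T"
        then have "\<bar>z - c\<bar> \<ge> e" using e by (force simp: dist_real_def)
        then show "z < c \<and> z < b \<or> c < z \<and> b < z" using that by linarith
      qed
      then show ?thesis using e by blast
    qed
    have "\<exists>b\<in>sample T. unseparated T q b \<and> (\<forall>(p', q') \<in> f. (p' < a \<longrightarrow> q' < b) \<and> (a < p' \<longrightarrow> b < q'))"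
    proof (cases "p < a")
      case True
      then have "L \<noteq> {}" using pq unfolding L_def by auto
      then obtain p1 m where m: "(p1, m) \<in> f" "p1 < a" "\<And>p q. (p, q) \<in> f \<Longrightarrow> p < a \<Longrightarrow> p \<le> p1 \<and> q \<le> m"
        using pred by blast
      have qm: "unseparated T q m"
        using unseparated_between(1)[OF pq(2), of p1] m pq True sim by auto
      obtain e where e: "e > 0" "\<And>b. \<bar>b - m\<bar> < e \<Longrightarrow> unseparated T m b" using near mem(2)[OF m(1)] by blast
      obtain M where M: "m < M" "\<And>p q. (p, q) \<in> f \<Longrightarrow> a < p \<Longrightarrow> M \<le> q"
      proof (cases "U = {}")
        case True then show ?thesis using that[of "m + 1"] unfolding U_def by auto
      next
        case False
        then obtain p2 M where "(p2, M) \<in> f" "a < p2" "\<forall>(p, q) \<in> f. a < p \<longrightarrow> p2 \<le> p \<and> M \<le> q"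
          using succ by blast
        then show ?thesis using that[of M] m ord[OF m(1)] by (metis (mono_tags, lifting) case_prodD less_trans)
      qed
      have "\<exists>b\<in>sample T. b \<in> {m<..<min M (m + e)}" by (rule ex_sample_in_open) (use clT M e in auto)
      then obtain b where b: "b \<in> sample T" "m < b" "b < M" "b < m + e" by auto
      have "unseparated T q b" using qm e(2)[of b] b unseparated_trans by auto
      moreover have "\<forall>(p', q') \<in> f. (p' < a \<longrightarrow> q' < b) \<and> (a < p' \<longrightarrow> b < q')"
        using m(3) M(2) b by fastforce
      ultimately show ?thesis using b by blast
    next
      case False
      then have ap: "a < p" using ne[OF pq(1)] by simp
      then have "U \<noteq> {}" using pq unfolding U_def by auto
      then obtain p2 M where M: "(p2, M) \<in> f" "a < p2" "\<And>p q. (p, q) \<in> f \<Longrightarrow> a < p \<Longrightarrow> p2 \<le> p \<and> M \<le> q"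
        using succ by blast
      have "unseparated S a p" using pq(2) unseparated_sym by blast
      then have "unseparated S p2 p"
        using unseparated_between(2)[of S a p p2] M pq(1) ap by auto
      then have qM: "unseparated T q M" using sim[OF M(1) pq(1)] unseparated_sym by blast
      obtain e where e: "e > 0" "\<And>b. \<bar>b - M\<bar> < e \<Longrightarrow> unseparated T M b" using near mem(2)[OF M(1)] by blast
      obtain m where m: "m < M" "\<And>p q. (p, q) \<in> f \<Longrightarrow> p < a \<Longrightarrow> q \<le> m"
      proof (cases "L = {}")
        case True then show ?thesis using that[of "M - 1"] unfolding L_def by auto
      next
        case False
        then obtain p1 m where "(p1, m) \<in> f" "p1 < a" "\<forall>(p, q) \<in> f. p < a \<longrightarrow> p \<le> p1 \<and> q \<le> m"
          using pred by blast
        then show ?thesis using that[of m] M ord[OF _ M(1)] by (metis (mono_tags, lifting) case_prodD less_trans)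
      qed
      have "\<exists>b\<in>sample T. b \<in> {max m (M - e)<..<M}" by (rule ex_sample_in_open) (use clT m e in auto)
      then obtain b where b: "b \<in> sample T" "m < b" "b < M" "M - e < b" by auto
      have "unseparated T q b" using qM e(2)[of b] b unseparated_trans by auto
      moreover have "\<forall>(p', q') \<in> f. (p' < a \<longrightarrow> q' < b) \<and> (a < p' \<longrightarrow> b < q')"
        using M(3) m(2) b by fastforce
      ultimately show ?thesis using b by blast
    qed
    then obtain b where b: "b \<in> sample T" "unseparated T q b"
      "\<And>p' q'. (p', q') \<in> f \<Longrightarrow> (p' < a \<longrightarrow> q' < b) \<and> (a < p' \<longrightarrow> b < q')" by blast
    show ?thesis
    proof (rule enough[of b])
      show "b \<in> T \<longleftrightarrow> a \<in> S"
        using unseparated_mem_iff[OF b(2)] unseparated_mem_iff[OF pq(2)] mem(3)[OF pq(1)] by simp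
      fix p' q' assume f': "(p', q') \<in> f"
      have "unseparated S p' a \<longleftrightarrow> unseparated S p' p"
        using pq(2) unseparated_trans unseparated_sym by blast
      also have "\<dots> \<longleftrightarrow> unseparated T q' q" by (rule sim[OF f' pq(1)])
      also have "\<dots> \<longleftrightarrow> unseparated T q' b"
        using b(2) unseparated_trans unseparated_sym by blast
      finally show "unseparated S p' a \<longleftrightarrow> unseparated T q' b" .
    qed (use b in auto)
  next
    case False
    have out: "unseparated S p a" if "(\<forall>s\<in>S. p < s \<and> a < s) \<or> (\<forall>s\<in>S. s < p \<and> s < a)" for p
      using that frontier_subset_closed[OF clS] unfolding unseparated_def by blast
    obtain p q where p: "(p, q) \<in> f" "\<forall>s\<in>S. p < s"
      using partial_matchD(7)[OF f] by blast
    obtain p' q' where p': "(p', q') \<in> f" "\<forall>s\<in>S. s < p'"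
      using partial_matchD(8)[OF f] by blast
    \<comment> \<open>The point \<open>a\<close> lies in none of the matched gaps, in particular in no unbounded one.\<close>
    have "p < a"
      using out[of p] False p ne[OF p(1)] by (meson linorder_neqE_linordered_idom less_trans)
    moreover have "a < p'"
      using out[of p'] False p' ne[OF p'(1)] by (meson linorder_neqE_linordered_idom less_trans)
    ultimately have "L \<noteq> {}" "U \<noteq> {}" using p p' unfolding L_def U_def by auto
    obtain p1 m where m: "(p1, m) \<in> f" "p1 < a" "\<And>p q. (p, q) \<in> f \<Longrightarrow> p < a \<Longrightarrow> p \<le> p1 \<and> q \<le> m"
      using pred[OF \<open>L \<noteq> {}\<close>] by blast
    obtain p2 M where M: "(p2, M) \<in> f" "a < p2" "\<And>p q. (p, q) \<in> f \<Longrightarrow> a < p \<Longrightarrow> p2 \<le> p \<and> M \<le> q"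
      using succ[OF \<open>U \<noteq> {}\<close>] by blast
    have mM: "m < M" using ord[OF m(1) M(1)] m M by auto
    have "\<not> unseparated S p1 p2" using False m M unseparated_between(1)[of S p1 p2 a] by auto
    then have nmM: "\<not> unseparated T m M" using sim[OF m(1) M(1)] by simp
    obtain b where b: "b \<in> sample T" "m < b" "b < M" "b \<in> T \<longleftrightarrow> a \<in> S" "\<not> unseparated T m b" "\<not> unseparated T b M"
      using ex_sample_between[OF T mM _ _ nmM, of "a \<in> S"] mem(2)[OF m(1)] mem(2)[OF M(1)]
      by (auto simp: sample_def)
    show ?thesis
    proof (rule enough[of b])
      fix p q assume f': "(p, q) \<in> f"
      have "\<not> unseparated T q b"
      proof (cases "p < a")
        case True
        then show ?thesis using m(3)[OF f'] b unseparated_between(2)[of T q b m] by auto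
      next
        case False
        then have "M \<le> q" using M(3)[OF f'] ne[OF f'] by auto
        then show ?thesis using b unseparated_between(1)[of T b q M] unseparated_sym[of T q b] by auto
      qed
      then show "unseparated S p a \<longleftrightarrow> unseparated T q b" using False f' by blast
    qed (use b m(3) M(3) in \<open>fastforce+\<close>)
  qed
qed

lemma ex_order_iso_of_samples:
  assumes S: "cantorval_like S" and T: "cantorval_like T"
  obtains G where "Domain G = sample S" "Range G = sample T"
    and "\<And>a b. (a, b) \<in> G \<Longrightarrow> a \<in> S \<longleftrightarrow> b \<in> T"
    and "\<And>a b a' b'. (a, b) \<in> G \<Longrightarrow> (a', b') \<in> G \<Longrightarrow> a < a' \<longleftrightarrow> b < b'"
proof -
  have cS: "compact S" "S \<noteq> {}" "closed S" and cT: "compact T" "T \<noteq> {}" "closed T"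
    using S T by (auto simp: cantorval_like_def compact_imp_closed)
  have ne: "sample S \<noteq> {}" "sample T \<noteq> {}"
    using ex_sample_in_open[OF cS(3) open_UNIV] ex_sample_in_open[OF cT(3) open_UNIV] by auto
  have cnt: "countable (sample S)" "countable (sample T)"
    unfolding sample_def using countable_rat by auto
  have step: "\<exists>g. partial_match S T g \<and> f \<subseteq> g \<and> from_nat_into (sample S) n \<in> Domain g \<and> from_nat_into (sample T) n \<in> Range g"
    if f: "partial_match S T f" for f n
  proof -
    obtain b where b: "partial_match S T (insert (from_nat_into (sample S) n, b) f)" (is "partial_match S T ?f")
      using partial_match_extend_domain[OF cS(3) T f from_nat_into[OF ne(1)]] by blast
    obtain a where "partial_match T S (insert (from_nat_into (sample T) n, a) (?f\<inverse>))"
      using partial_match_extend_domain[OF cT(3) S partial_match_converse[OF b] from_nat_into[OF ne(2)]] by blast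
    then have "partial_match S T ((insert (from_nat_into (sample T) n, a) (?f\<inverse>))\<inverse>)"
      by (rule partial_match_converse)
    then show ?thesis by (intro exI conjI) auto
  qed
  have "\<exists>F. \<forall>n. partial_match S T (F n) \<and>
    (F n \<subseteq> F (Suc n) \<and> from_nat_into (sample S) n \<in> Domain (F (Suc n)) \<and> from_nat_into (sample T) n \<in> Range (F (Suc n)))"
    using ex_partial_match[OF cS(1,2) cT(1,2)] step by (intro dependent_nat_choice) blast+
  then obtain F where F: "\<And>n. partial_match S T (F n)" "\<And>n. F n \<subseteq> F (Suc n)"
    "\<And>n. from_nat_into (sample S) n \<in> Domain (F (Suc n))" "\<And>n. from_nat_into (sample T) n \<in> Range (F (Suc n))"
    by blast
  have mono: "F m \<subseteq> F n" if "m \<le> n" for m n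
    using lift_Suc_mono_le[of F, OF F(2) that] .
  have "\<exists>n. (a, b) \<in> F n \<and> (a', b') \<in> F n" if "(a, b) \<in> (\<Union>n. F n)" "(a', b') \<in> (\<Union>n. F n)" for a b a' b'
  proof -
    obtain i j where "(a, b) \<in> F i" "(a', b') \<in> F j" using \<open>(a, b) \<in> (\<Union>n. F n)\<close> \<open>(a', b') \<in> (\<Union>n. F n)\<close> by blast
    then show ?thesis using mono[of i "max i j"] mono[of j "max i j"] by (intro exI[of _ "max i j"]) auto
  qed
  then have "a < a' \<longleftrightarrow> b < b'" if "(a, b) \<in> (\<Union>n. F n)" "(a', b') \<in> (\<Union>n. F n)" for a b a' b'
    using that partial_matchD(5)[OF F(1)] by meson
  moreover have "a \<in> S \<longleftrightarrow> b \<in> T" if "(a, b) \<in> (\<Union>n. F n)" for a b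
    using that partial_matchD(4)[OF F(1)] by blast
  moreover have "Domain (\<Union>n. F n) = sample S"
  proof
    show "Domain (\<Union>n. F n) \<subseteq> sample S" using partial_matchD(2)[OF F(1)] by blast
    show "sample S \<subseteq> Domain (\<Union>n. F n)"
    proof
      fix a assume "a \<in> sample S"
      then obtain n where "a = from_nat_into (sample S) n"
        using from_nat_into_surj[OF cnt(1)] by metis
      then show "a \<in> Domain (\<Union>n. F n)" using F(3)[of n] by blast
    qed
  qed
  moreover have "Range (\<Union>n. F n) = sample T"
  proof
    show "Range (\<Union>n. F n) \<subseteq> sample T" using partial_matchD(3)[OF F(1)] by blast
    show "sample T \<subseteq> Range (\<Union>n. F n)"
    proof
      fix a assume "a \<in> sample T"
      then obtain n where "a = from_nat_into (sample T) n"
        using from_nat_into_surj[OF cnt(2)] by metis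
      then show "a \<in> Range (\<Union>n. F n)" using F(4)[of n] by blast
    qed
  qed
  ultimately show thesis using that[of "\<Union>n. F n"] by simp
qed

text \<open>An increasing bijection, given by its graph, between dense sets of reals extends to the whole line by
  taking suprema over smaller points.\<close>

lemma order_iso_of_dense_sets_extends:
  fixes G :: "(real \<times> real) set"
  assumes dA: "\<And>x y. x < y \<Longrightarrow> \<exists>a \<in> Domain G. x < a \<and> a < y"
    and dB: "\<And>x y. x < y \<Longrightarrow> \<exists>b \<in> Range G. x < b \<and> b < y"
    and ord: "\<And>a b a' b'. (a, b) \<in> G \<Longrightarrow> (a', b') \<in> G \<Longrightarrow> a < a' \<longleftrightarrow> b < b'"
  obtains h where "strict_mono h" "surj h" "\<And>a b. (a, b) \<in> G \<Longrightarrow> h a = b"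
proof -
  define h where "h x = Sup {b. \<exists>a. (a, b) \<in> G \<and> a \<le> x}" for x
  define L where "L x = {b. \<exists>a. (a, b) \<in> G \<and> a \<le> x}" for x
  have hL: "h x = Sup (L x)" for x unfolding h_def L_def ..
  have le: "a \<le> a' \<longleftrightarrow> b \<le> b'" if "(a, b) \<in> G" "(a', b') \<in> G" for a b a' b'
    using ord[OF that(2,1)] by linarith
  have below: "\<exists>a b. (a, b) \<in> G \<and> x < a \<and> a < y" if "x < y" for x y using dA[OF that] by blast
  have ne: "L x \<noteq> {}" for x using below[of "x - 1" x] unfolding L_def by fastforce
  have bdd: "bdd_above (L x)" for x
  proof -
    obtain a b where ab: "(a, b) \<in> G" "x < a" using below[of x "x + 1"] by auto
    have "c \<le> b" if "c \<in> L x" for c using that ab le unfolding L_def by fastforce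
    then show ?thesis by (rule bdd_aboveI)
  qed
  have upper: "b \<le> h x" if "(a, b) \<in> G" "a \<le> x" for a b x
    unfolding hL by (rule cSup_upper[OF _ bdd]) (use that in \<open>auto simp: L_def\<close>)
  have least: "h x \<le> z" if "\<And>a b. (a, b) \<in> G \<Longrightarrow> a \<le> x \<Longrightarrow> b \<le> z" for x z
    unfolding hL by (rule cSup_least[OF ne]) (use that in \<open>auto simp: L_def\<close>)
  have hG: "h a = b" if ab: "(a, b) \<in> G" for a b
  proof (rule antisym)
    show "h a \<le> b" by (rule least) (use le[OF _ ab] in blast)
    show "b \<le> h a" by (rule upper[OF ab order_refl])
  qed
  have mono: "h x \<le> h y" if "x \<le> y" for x y
  proof (rule least)
    show "b \<le> h y" if "(a, b) \<in> G" "a \<le> x" for a b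
      using upper[OF that(1)] that(2) \<open>x \<le> y\<close> by (meson order_trans)
  qed
  have "strict_mono h"
  proof
    fix x y :: real assume "x < y"
    then obtain a b where ab: "(a, b) \<in> G" "x < a" "a < y" using below by blast
    obtain a' b' where ab': "(a', b') \<in> G" "a < a'" "a' < y" using below ab by blast
    have "h x \<le> b" using mono[of x a] hG ab by auto
    also have "b < b'" using ord ab ab' by blast
    also have "b' \<le> h y" using mono[of a' y] hG ab' by auto
    finally show "h x < h y" .
  qed
  moreover have "\<exists>x. h x = z" for z
  proof -
    define K where "K = {a. \<exists>b. (a, b) \<in> G \<and> b \<le> z}"
    obtain a0 b0 where 0: "(a0, b0) \<in> G" "b0 < z" using dB[of "z - 1" z] by auto
    obtain a1 b1 where 1: "(a1, b1) \<in> G" "z < b1" using dB[of z "z + 1"] by auto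
    have K1: "a \<le> c" if "a \<in> K" "(c, d) \<in> G" "z \<le> d" for a c d
      using that le unfolding K_def by fastforce
    have bK: "bdd_above K" using K1[OF _ 1(1)] 1(2) by (meson bdd_aboveI less_imp_le)
    have "a0 \<in> K" using 0 unfolding K_def by auto
    have "\<not> h (Sup K) < z"
    proof
      assume "h (Sup K) < z"
      then obtain a b where b: "(a, b) \<in> G" "h (Sup K) < b" "b < z" using dB by blast
      then have "a \<le> Sup K" using bK by (intro cSup_upper) (auto simp: K_def)
      then have "b \<le> h (Sup K)" by (rule upper[OF b(1)])
      then show False using b by linarith
    qed
    moreover have "\<not> z < h (Sup K)"
    proof
      assume "z < h (Sup K)"
      then obtain a b where b: "(a, b) \<in> G" "z < b" "b < h (Sup K)" using dB by blast
      then have "Sup K \<le> a" using K1 \<open>a0 \<in> K\<close> by (intro cSup_least) auto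
      then have "h (Sup K) \<le> b" using mono[of "Sup K" a] hG[OF b(1)] by simp
      then show False using b by linarith
    qed
    ultimately have "h (Sup K) = z" by linarith
    then show ?thesis ..
  qed
  then have "surj h" by (metis surjI)
  ultimately show thesis using hG that by blast
qed

lemma strict_mono_surj_continuous:
  fixes h :: "real \<Rightarrow> real"
  assumes "strict_mono h" "surj h"
  shows "continuous_on UNIV h"
  using assms by (intro continuous_onI_mono) (auto simp: strict_mono_less_eq)

lemma subset_closure_sample:
  assumes "cantorval_like S"
  shows "S \<subseteq> closure (sample S \<inter> S)"
proof -
  have cl: "closed S" and reg: "S \<subseteq> closure (interior S)"
    using assms by (auto simp: cantorval_like_def compact_imp_closed)
  have "interior S \<subseteq> closure (sample S \<inter> S)"
  proof
    fix x assume x: "x \<in> interior S"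
    show "x \<in> closure (sample S \<inter> S)"
      unfolding closure_iff_nhds_not_empty
    proof (intro allI impI)
      fix A V assume "V \<subseteq> A" "open V" "x \<in> V"
      then have "\<exists>r\<in>sample S. r \<in> interior S \<inter> V"
        using x by (intro ex_sample_in_open cl) auto
      then show "sample S \<inter> S \<inter> A \<noteq> {}" using \<open>V \<subseteq> A\<close> interior_subset by blast
    qed
  qed
  then show ?thesis using reg by (meson closed_closure closure_minimal order_trans)
qed

theorem cantorval_like_homeomorphic:
  assumes S: "cantorval_like S" and T: "cantorval_like T"
  shows "S homeomorphic T"
proof -
  have clS: "closed S" and clT: "closed T" and compS: "compact S"
    using S T by (auto simp: cantorval_like_def compact_imp_closed)
  obtain G where G: "Domain G = sample S" "Range G = sample T"
    "\<And>a b. (a, b) \<in> G \<Longrightarrow> a \<in> S \<longleftrightarrow> b \<in> T"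
    "\<And>a b a' b'. (a, b) \<in> G \<Longrightarrow> (a', b') \<in> G \<Longrightarrow> a < a' \<longleftrightarrow> b < b'"
    by (rule ex_order_iso_of_samples[OF S T]) (rule that)
  have dS: "\<exists>a\<in>Domain G. x < a \<and> a < y" if "x < y" for x y
    using ex_sample_in_open[OF clS, of "{x<..<y}"] that G(1) by auto
  have dT: "\<exists>b\<in>Range G. x < b \<and> b < y" if "x < y" for x y
    using ex_sample_in_open[OF clT, of "{x<..<y}"] that G(2) by auto
  obtain h where h: "strict_mono h" "surj h" "\<And>a b. (a, b) \<in> G \<Longrightarrow> h a = b"
    by (rule order_iso_of_dense_sets_extends[OF dS dT G(4)]) (assumption | rule that)+
  have cont: "continuous_on UNIV h" using strict_mono_surj_continuous h by blast
  have inj: "inj h" using h(1) strict_mono_imp_inj_on by blast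
  have "h ` S \<subseteq> T"
  proof -
    have "h ` closure (sample S \<inter> S) \<subseteq> T"
    proof (rule image_closure_subset)
      show "continuous_on (closure (sample S \<inter> S)) h" using cont continuous_on_subset by blast
      show "h ` (sample S \<inter> S) \<subseteq> T" using G h(3) by blast
    qed (rule clT)
    then show ?thesis using subset_closure_sample[OF S] by blast
  qed
  moreover have "T \<subseteq> h ` S"
  proof -
    have "closed (h ` S)"
      using compS cont by (meson compact_continuous_image compact_imp_closed continuous_on_subset subset_UNIV)
    moreover have "sample T \<inter> T \<subseteq> h ` S"
    proof
      fix b assume "b \<in> sample T \<inter> T"
      then obtain a where "(a, b) \<in> G" "a \<in> S" using G(2,3) by blast
      then show "b \<in> h ` S" using h(3) by blast
    qed
    ultimately show ?thesis using subset_closure_sample[OF T] closure_minimal by blast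
  qed
  ultimately have "h ` S = T" by blast
  moreover have "continuous_on S h" "inj_on h S"
    using cont inj by (auto intro: continuous_on_subset inj_on_subset)
  ultimately show ?thesis
    using homeomorphic_compact[OF compS] by blast
qed

section \<open>Achievement sets of positive summable sequences\<close>

locale positive_summable =
  fixes x :: "nat \<Rightarrow> real"
  assumes pos: "0 < x n" and summable: "summable x"
begin

text \<open>The sums of all subseries with indices in \<open>B\<close>.\<close>

definition subsums :: "nat set \<Rightarrow> real set" where
  "subsums B = infsum x ` Pow B"

text \<open>The sum of all terms from index \<open>n\<close> on, the term \<open>x n\<close> included. Thus \<open>n\<close> is a gap index if
  \<open>tail (Suc n) < x n\<close>.\<close>

definition tail :: "nat \<Rightarrow> real" where
  "tail n = infsum x {n..}"

lemma achievement_set_eq: "achievement_set x = subsums UNIV"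
  unfolding achievement_set_def subsums_def by simp

lemma summable_on: "x summable_on A"
  using summable_on_subset_banach[of x UNIV A] summable_on_UNIV_nonneg_real_iff[of x] summable pos
  by (simp add: less_imp_le)

lemma infsum_ge_0: "0 \<le> infsum x A"
  by (intro infsum_nonneg) (simp add: less_imp_le pos)

lemma infsum_mono_subset: "A \<subseteq> B \<Longrightarrow> infsum x A \<le> infsum x B"
  by (intro infsum_mono2 summable_on) (auto simp: less_imp_le pos)

lemma infsum_disjoint: "A \<inter> B = {} \<Longrightarrow> infsum x (A \<union> B) = infsum x A + infsum x B"
  by (intro infsum_Un_disjoint summable_on)

lemma infsum_split: "infsum x A = sum x (A \<inter> {..<n}) + infsum x (A \<inter> {n..})"
proof -
  have "A = (A \<inter> {..<n}) \<union> (A \<inter> {n..})" by auto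
  then have "infsum x A = infsum x (A \<inter> {..<n}) + infsum x (A \<inter> {n..})"
    using infsum_disjoint[of "A \<inter> {..<n}" "A \<inter> {n..}"] by fastforce
  then show ?thesis by simp
qed

lemma infsum_UNIV: "infsum x UNIV = suminf x"
  using norm_summable_imp_has_sum[of x "suminf x"] summable pos
  by (intro infsumI) (simp add: less_imp_le summable_sums)

lemma tail_eq_diff: "tail n = suminf x - sum x {..<n}"
  using infsum_split[of UNIV n] infsum_UNIV unfolding tail_def by simp

lemma tail_Suc: "tail n = x n + tail (Suc n)"
  unfolding tail_eq_diff by simp

lemma tail_tendsto_0: "tail \<longlonglongrightarrow> 0"
proof -
  have "(\<lambda>n. suminf x - sum x {..<n}) \<longlonglongrightarrow> suminf x - suminf x"
    using summable by (intro tendsto_intros summable_LIMSEQ)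
  then show ?thesis by (simp add: tail_eq_diff[abs_def])
qed

lemma tail_pos: "0 < tail n"
  using tail_Suc[of n] pos[of n] infsum_ge_0[of "{Suc n..}"] unfolding tail_def by simp

lemma ex_tail_less:
  assumes "0 < e"
  shows "\<exists>n\<ge>m. tail n < e"
proof -
  have "\<forall>\<^sub>F n in sequentially. tail n < e"
    using order_tendstoD(2)[OF tail_tendsto_0 assms] .
  then obtain N where "\<And>n. N \<le> n \<Longrightarrow> tail n < e" unfolding eventually_sequentially by blast
  then show ?thesis by (intro exI[of _ "max m N"]) simp
qed

lemma infsum_le_tail: "A \<subseteq> {n..} \<Longrightarrow> infsum x A \<le> tail n"
  unfolding tail_def by (rule infsum_mono_subset)

lemma infsum_mem_le: "k \<in> A \<Longrightarrow> x k \<le> infsum x A"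
  using infsum_mono_subset[of "{k}" A] by simp

lemma infsum_eq_suminf: "infsum x A = (\<Sum>k. indicator A k * x k)"
proof -
  have "infsum x A = infsum (\<lambda>k. indicator A k * x k) UNIV"
    by (intro infsum_cong_neutral) auto
  moreover have "summable (\<lambda>k. norm (indicator A k * x k))"
  proof (rule summable_comparison_test'[OF summable, of 0])
    show "norm (norm (indicator A k * x k)) \<le> x k" for k
      using pos[of k] by (cases "k \<in> A") auto
  qed
  then have "((\<lambda>k. indicator A k * x k) has_sum (\<Sum>k. indicator A k * x k)) UNIV"
    by - (rule norm_summable_imp_has_sum[OF _ summable_sums[OF summable_norm_cancel]], assumption+)
  then have "infsum (\<lambda>k. indicator A k * x k) UNIV = (\<Sum>k. indicator A k * x k)"
    by (rule infsumI)
  ultimately show ?thesis by simp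
qed

text \<open>The set of subseries sums is the image of a product of finite sets under a map that is continuous
  for the product topology, by uniform convergence.\<close>

lemma compact_subsums: "compact (subsums B)"
proof -
  define P :: "(nat \<Rightarrow> real) set" where "P = (\<Pi>\<^sub>E k\<in>UNIV. if k \<in> B then {0, 1} else {0})"
  define s where "s f = (\<Sum>k. f k * x k)" for f :: "nat \<Rightarrow> real"
  have "compactin (product_topology (\<lambda>_. euclidean) UNIV) P"
    unfolding P_def by (subst compactin_PiE) (auto simp: compactin_euclidean_iff)
  then have "compact P" by (simp add: euclidean_product_topology)
  moreover have "continuous_on P s"
  proof (rule uniform_limit_theorem)
    have "\<bar>f k * x k\<bar> \<le> x k" if "f \<in> P" for f k
    proof -
      have "f k = 0 \<or> f k = 1" using that unfolding P_def by (auto simp: PiE_iff split: if_splits dest: spec[of _ k])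
      then show ?thesis using pos[of k] by auto
    qed
    then show "uniform_limit P (\<lambda>n f. \<Sum>k<n. f k * x k) s sequentially"
      unfolding s_def using summable by (intro Weierstrass_m_test) auto
    show "\<forall>\<^sub>F n in sequentially. continuous_on P (\<lambda>f. \<Sum>k<n. f k * x k)"
      by (intro always_eventually allI continuous_intros)
        (auto intro: continuous_on_subset[OF continuous_on_product_coordinates])
  qed simp
  moreover have "s ` P = subsums B"
  proof
    show "s ` P \<subseteq> subsums B"
    proof safe
      fix f assume f: "f \<in> P"
      have "f = indicator {k. f k = 1}"
      proof
        fix k
        have "f k = 0 \<or> f k = 1" using f unfolding P_def by (auto simp: PiE_iff split: if_splits dest: spec[of _ k])
        then show "f k = indicator {k. f k = 1} k" by auto
      qed
      then have "s f = infsum x {k. f k = 1}" unfolding s_def infsum_eq_suminf by metis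
      moreover have "{k. f k = 1} \<subseteq> B"
        using f unfolding P_def by (auto simp: PiE_iff split: if_splits)
      ultimately show "s f \<in> subsums B" unfolding subsums_def by auto
    qed
    show "subsums B \<subseteq> s ` P"
    proof
      fix t assume "t \<in> subsums B"
      then obtain A where A: "A \<subseteq> B" "t = infsum x A" unfolding subsums_def by auto
      then have "indicator A \<in> P" unfolding P_def by (auto simp: indicator_def)
      moreover have "s (indicator A) = t" unfolding A(2) infsum_eq_suminf s_def ..
      ultimately show "t \<in> s ` P" by blast
    qed
  qed
  ultimately show ?thesis by (metis compact_continuous_image)
qed

definition finite_subsums :: "nat \<Rightarrow> real set" where
  "finite_subsums n = sum x ` Pow {..<n}"

lemma finite_finite_subsums: "finite (finite_subsums n)"
  unfolding finite_subsums_def by simp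

text \<open>The achievement set consists of finitely many translates of its small piece \<open>subsums {n..}\<close>, which
  lies in \<open>{0..tail n}\<close>.\<close>

lemma achievement_set_decompose:
  "achievement_set x = (\<Union>f\<in>finite_subsums n. (+) f ` subsums {n..})"
proof
  show "achievement_set x \<subseteq> (\<Union>f\<in>finite_subsums n. (+) f ` subsums {n..})"
  proof
    fix t assume "t \<in> achievement_set x"
    then obtain A where "t = infsum x A" unfolding achievement_set_def by blast
    then have "t = sum x (A \<inter> {..<n}) + infsum x (A \<inter> {n..})" by (simp only: infsum_split[of A n])
    moreover have "sum x (A \<inter> {..<n}) \<in> finite_subsums n" "infsum x (A \<inter> {n..}) \<in> subsums {n..}"
      unfolding finite_subsums_def subsums_def by auto
    ultimately show "t \<in> (\<Union>f\<in>finite_subsums n. (+) f ` subsums {n..})" by blast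
  qed
  show "(\<Union>f\<in>finite_subsums n. (+) f ` subsums {n..}) \<subseteq> achievement_set x"
  proof safe
    fix f e assume "f \<in> finite_subsums n" "e \<in> subsums {n..}"
    then obtain B A where BA: "B \<subseteq> {..<n}" "f = sum x B" "A \<subseteq> {n..}" "e = infsum x A"
      unfolding finite_subsums_def subsums_def by auto
    have "finite B" using BA(1) finite_subset by blast
    moreover have "B \<inter> A = {}" using BA(1,3) by (meson Int_emptyI atLeast_iff lessThan_iff not_le subsetD)
    ultimately have "f + e = infsum x (B \<union> A)" using infsum_disjoint[of B A] BA by simp
    then show "f + e \<in> achievement_set x" unfolding achievement_set_def by blast
  qed
qed

lemma subsums_bounds:
  assumes "e \<in> subsums {n..}"
  shows "0 \<le> e" "e \<le> tail n"
  using assms infsum_ge_0 infsum_le_tail unfolding subsums_def by auto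

lemma finite_subsums_subset: "finite_subsums n \<subseteq> achievement_set x"
proof
  fix f assume "f \<in> finite_subsums n"
  then obtain B where "B \<subseteq> {..<n}" "f = sum x B" unfolding finite_subsums_def by blast
  moreover from this have "finite B" using finite_subset by blast
  ultimately have "f = infsum x B" by simp
  then show "f \<in> achievement_set x" unfolding achievement_set_def by blast
qed

lemma interior_subsums_nonempty:
  assumes "interior (achievement_set x) \<noteq> {}"
  shows "interior (subsums {n..}) \<noteq> {}"
proof
  assume e: "interior (subsums {n..}) = {}"
  have "interior (\<Union>f\<in>F. (+) f ` subsums {n..}) = {}" if "finite F" for F
    using that
  proof induction
    case (insert f F)
    have "closed ((+) f ` subsums {n..})"
      using compact_subsums by (intro closed_translation compact_imp_closed)
    then show ?case
      using insert e by (simp add: interior_closed_Un_empty_interior interior_translation)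
  qed simp
  then show False using assms finite_finite_subsums[of n] achievement_set_decompose[of n] by simp
qed

lemma achievement_set_regular:
  assumes "interior (achievement_set x) \<noteq> {}"
  shows "achievement_set x \<subseteq> closure (interior (achievement_set x))"
proof
  fix t assume t: "t \<in> achievement_set x"
  show "t \<in> closure (interior (achievement_set x))"
    unfolding closure_approachable
  proof (intro allI impI)
    fix e :: real assume "0 < e"
    then obtain n where n: "tail n < e" using ex_tail_less by blast
    obtain f s where fs: "f \<in> finite_subsums n" "s \<in> subsums {n..}" "t = f + s"
      using t achievement_set_decompose[of n] by auto
    obtain w where w: "w \<in> interior (subsums {n..})"
      using interior_subsums_nonempty[OF assms] by blast
    have "(+) f ` subsums {n..} \<subseteq> achievement_set x"
      using fs(1) achievement_set_decompose[of n] by auto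
    then have "interior ((+) f ` subsums {n..}) \<subseteq> interior (achievement_set x)"
      by (rule interior_mono)
    then have "f + w \<in> interior (achievement_set x)"
      using w by (auto simp: interior_translation)
    moreover have "dist (f + w) t < e"
      using fs n subsums_bounds[of w n] subsums_bounds[of s n] w interior_subset[of "subsums {n..}"]
      by (auto simp: dist_real_def)
    ultimately show "\<exists>y\<in>interior (achievement_set x). dist y t < e" by blast
  qed
qed

text \<open>A subseries that uses an index up to \<open>m\<close> has sum at least \<open>x m\<close>, any other one has sum at most
  \<open>tail (Suc m)\<close>.\<close>

lemma gap_near_zero:
  assumes dec: "decseq x" and m: "n \<le> m" "tail (Suc m) < c" "c < x m"
  shows "c \<notin> subsums {n..}"
proof
  assume "c \<in> subsums {n..}"
  then obtain A where A: "A \<subseteq> {n..}" "c = infsum x A" unfolding subsums_def by auto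
  show False
  proof (cases "\<exists>k\<in>A. k \<le> m")
    case True
    then obtain k where "k \<in> A" "k \<le> m" by blast
    then have "x m \<le> infsum x A" using decseqD[OF dec] infsum_mem_le by (blast intro: order_trans)
    then show False using A m by simp
  next
    case False
    then have "A \<subseteq> {Suc m..}" by (auto simp: not_le Suc_le_eq)
    then show False using infsum_le_tail[of A "Suc m"] A m by simp
  qed
qed

text \<open>If \<open>v\<close> is the right endpoint of a gap longer than \<open>tail n\<close>, then \<open>v\<close> is itself a sum of terms with
  indices below \<open>n\<close>, and near \<open>v\<close> on the right only the translate of \<open>subsums {n..}\<close> by \<open>v\<close> is
  present. It has gaps close to its left end.\<close>

lemma gaps_right:
  assumes dec: "decseq x" and inf: "\<exists>\<^sub>\<infinity>n. tail (Suc n) < x n"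
    and v: "v \<in> achievement_set x" "p < v" "{p<..<v} \<inter> achievement_set x = {}" "v < e"
  shows "\<exists>c. v < c \<and> c < e \<and> c \<notin> achievement_set x"
proof -
  obtain n where n: "tail n < v - p" using ex_tail_less[of "v - p" 0] v by auto
  \<comment> \<open>No translate of the small piece starts strictly between \<open>v\<close> and \<open>u\<close>.\<close>
  have "finite (insert e {f \<in> finite_subsums n. v < f})" using finite_finite_subsums by simp
  then obtain u where u: "v < u" "u \<le> e" "\<And>f. f \<in> finite_subsums n \<Longrightarrow> v < f \<Longrightarrow> u \<le> f"
  proof -
    let ?M = "insert e {f \<in> finite_subsums n. v < f}"
    assume fin: "finite ?M"
    have "Min ?M \<in> ?M" using fin by (intro Min_in) auto
    then have "v < Min ?M" using v by auto
    then show thesis using that[of "Min ?M"] fin by auto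
  qed
  obtain N where N: "tail N < u - v" using ex_tail_less[of "u - v" 0] u by auto
  obtain m where m: "max n N \<le> m" "tail (Suc m) < x m" using inf unfolding INFM_nat_le by blast
  have "tail m \<le> tail N" unfolding tail_def by (rule infsum_mono_subset) (use m in auto)
  then have xm: "x m < u - v" using N tail_Suc[of m] tail_pos[of "Suc m"] by linarith
  obtain c where c: "tail (Suc m) < c" "c < x m" using dense[OF m(2)] by blast
  have "v + c \<notin> achievement_set x"
  proof
    assume "v + c \<in> achievement_set x"
    then obtain f s where fs: "f \<in> finite_subsums n" "s \<in> subsums {n..}" "v + c = f + s"
      using achievement_set_decompose[of n] by auto
    have s: "0 \<le> s" "s \<le> tail n" using subsums_bounds[OF fs(2)] by auto
    have fE: "f \<in> achievement_set x" using fs(1) finite_subsums_subset by blast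
    consider "f < v" | "f = v" | "v < f" by linarith
    then show False
    proof cases
      case 1
      then have "f \<le> p" using fE v(3) by (metis IntI empty_iff greaterThanLessThan_iff not_le)
      then show False using n s fs(3) c tail_pos[of "Suc m"] by linarith
    next
      case 2
      then have "s = c" using fs(3) by simp
      then show False using gap_near_zero[OF dec _ c, of n] m fs(2) by auto
    next
      case 3
      then show False using u(3)[OF fs(1)] fs(3) s c xm by linarith
    qed
  qed
  moreover have "v < v + c" "v + c < e" using c tail_pos[of "Suc m"] xm u by linarith+
  ultimately show ?thesis by blast
qed

lemma achievement_set_symmetric:
  "t \<in> achievement_set x \<longleftrightarrow> suminf x - t \<in> achievement_set x"
proof -
  have *: "suminf x - t \<in> achievement_set x" if "t \<in> achievement_set x" for t
  proof -
    obtain A where "t = infsum x A" using \<open>t \<in> achievement_set x\<close> unfolding achievement_set_def by blast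
    moreover have "infsum x A + infsum x (- A) = suminf x"
      using infsum_disjoint[of A "- A"] infsum_UNIV by simp
    ultimately have "suminf x - t = infsum x (- A)" by linarith
    then show ?thesis unfolding achievement_set_def by blast
  qed
  show ?thesis
  proof
    assume "suminf x - t \<in> achievement_set x"
    then have "suminf x - (suminf x - t) \<in> achievement_set x" by (rule *)
    then show "t \<in> achievement_set x" by simp
  qed (rule *)
qed

text \<open>The mirror image of \<open>gaps_right\<close> under the symmetry \<open>achievement_set_symmetric\<close>.\<close>

lemma gaps_left:
  assumes dec: "decseq x" and inf: "\<exists>\<^sub>\<infinity>n. tail (Suc n) < x n"
    and u: "u \<in> achievement_set x" "u < q" "{u<..<q} \<inter> achievement_set x = {}" "e < u"
  shows "\<exists>c. e < c \<and> c < u \<and> c \<notin> achievement_set x"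
proof -
  let ?r = "\<lambda>t. suminf x - t"
  have "{?r q<..<?r u} \<inter> achievement_set x = {}"
  proof (rule ccontr)
    assume "{?r q<..<?r u} \<inter> achievement_set x \<noteq> {}"
    then obtain t where "t \<in> achievement_set x" "?r q < t" "t < ?r u" by auto
    then have "?r t \<in> {u<..<q} \<inter> achievement_set x" using achievement_set_symmetric[of t] by auto
    then show False using u by blast
  qed
  then obtain c where "?r u < c" "c < ?r e" "c \<notin> achievement_set x"
    using gaps_right[OF dec inf, of "?r u" "?r q" "?r e"] u achievement_set_symmetric[of u] by auto
  then show ?thesis using achievement_set_symmetric[of c] by (intro exI[of _ "?r c"]) auto
qed

lemma compact_achievement_set: "compact (achievement_set x)"
  unfolding achievement_set_eq by (rule compact_subsums)

theorem cantorval_like_achievement_set: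
  assumes "decseq x" "\<exists>\<^sub>\<infinity>n. tail (Suc n) < x n" "interior (achievement_set x) \<noteq> {}"
  shows "cantorval_like (achievement_set x)"
  unfolding cantorval_like_def
proof (intro conjI allI impI)
  show "achievement_set x \<noteq> {}" by (simp add: achievement_set_def)
qed (use assms in \<open>auto intro: compact_achievement_set achievement_set_regular[THEN subsetD] gaps_left gaps_right\<close>)

text \<open>Kakeya's theorem: without gap indices from \<open>N\<close> on, all values up to \<open>tail N\<close> are attained. The
  induction approximates \<open>t\<close> from below by finite sums, with error at most \<open>tail n\<close>.\<close>

lemma subsums_eq_interval:
  assumes "\<And>n. N \<le> n \<Longrightarrow> x n \<le> tail (Suc n)"
  shows "subsums {N..} = {0..tail N}"
proof
  show "subsums {N..} \<subseteq> {0..tail N}" using subsums_bounds by auto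
  show "{0..tail N} \<subseteq> subsums {N..}"
  proof
    fix t assume t: "t \<in> {0..tail N}"
    have approx: "\<exists>B\<subseteq>{N..<n}. sum x B \<le> t \<and> t \<le> sum x B + tail n" if "N \<le> n" for n
      using that
    proof (induction n rule: dec_induct)
      case base
      then show ?case using t by auto
    next
      case (step n)
      then obtain B where B: "B \<subseteq> {N..<n}" "sum x B \<le> t" "t \<le> sum x B + tail n" by blast
      show ?case
      proof (cases "sum x B + x n \<le> t")
        case True
        have "sum x (insert n B) = x n + sum x B"
          using B(1) by (subst sum.insert) (auto intro: finite_subset)
        then show ?thesis
          using True B step(1) tail_Suc[of n] by (intro exI[of _ "insert n B"]) auto
      next
        case False
        then show ?thesis
          using B assms[OF step(1)] by (intro exI[of _ B]) auto
      qed
    qed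
    have "t \<in> closure (subsums {N..})"
      unfolding closure_approachable
    proof (intro allI impI)
      fix e :: real assume "0 < e"
      then obtain n where n: "N \<le> n" "tail n < e" using ex_tail_less by blast
      obtain B where B: "B \<subseteq> {N..<n}" "sum x B \<le> t" "t \<le> sum x B + tail n" using approx[OF n(1)] by blast
      have "finite B" using B(1) finite_subset by blast
      then have "sum x B = infsum x B" by simp
      moreover have "B \<subseteq> {N..}" using B(1) by auto
      ultimately have "sum x B \<in> subsums {N..}" unfolding subsums_def by auto
      moreover have "dist (sum x B) t < e" using B n by (auto simp: dist_real_def)
      ultimately show "\<exists>y\<in>subsums {N..}. dist y t < e" by blast
    qed
    then show "t \<in> subsums {N..}"
      using compact_subsums compact_imp_closed closure_closed by metis
  qed
qed

lemma infinitely_many_gaps_if_singleton_component: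
  assumes p: "p \<in> achievement_set x"
    and comp: "\<And>C. C \<subseteq> achievement_set x \<Longrightarrow> connected C \<Longrightarrow> p \<in> C \<Longrightarrow> C = {p}"
  shows "\<exists>\<^sub>\<infinity>n. tail (Suc n) < x n"
proof (rule ccontr)
  assume "\<not> (\<exists>\<^sub>\<infinity>n. tail (Suc n) < x n)"
  then obtain N where "\<And>n. N \<le> n \<Longrightarrow> x n \<le> tail (Suc n)"
    unfolding INFM_nat_le by (meson not_le)
  then have int: "subsums {N..} = {0..tail N}" by (rule subsums_eq_interval)
  obtain f s where fs: "f \<in> finite_subsums N" "s \<in> subsums {N..}" "p = f + s"
    using p achievement_set_decompose[of N] by auto
  let ?C = "(+) f ` {0..tail N}"
  have "?C \<subseteq> achievement_set x" using fs(1) int achievement_set_decompose[of N] by auto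
  moreover have "connected ?C" by simp
  moreover have "p \<in> ?C" using fs int by auto
  ultimately have "?C = {p}" by (rule comp)
  moreover have "f + 0 \<in> ?C" "f + tail N \<in> ?C"
    using tail_pos[of N] by (intro imageI; simp)+
  ultimately have "f + 0 = p" "f + tail N = p" by (metis singletonD)+
  then show False using tail_pos[of N] by simp
qed

lemma singleton_component_0:
  assumes dec: "decseq x" and inf: "\<exists>\<^sub>\<infinity>n. tail (Suc n) < x n"
    and C: "C \<subseteq> achievement_set x" "connected C" "0 \<in> C"
  shows "C = {0}"
proof (rule ccontr)
  assume "C \<noteq> {0}"
  then obtain c where c: "c \<in> C" "c \<noteq> 0" using C(3) by blast
  then obtain A where "c = infsum x A" using C(1) unfolding achievement_set_def by blast
  then have "0 < c" using infsum_ge_0[of A] c(2) by linarith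
  then obtain N where N: "tail N < c" using ex_tail_less[of c 0] by blast
  obtain m where m: "N \<le> m" "tail (Suc m) < x m" using inf unfolding INFM_nat_le by blast
  obtain d where d: "tail (Suc m) < d" "d < x m" using dense[OF m(2)] by blast
  have "tail m \<le> tail N" unfolding tail_def by (rule infsum_mono_subset) (use m in auto)
  then have "0 < d" "d < c" using d N tail_Suc[of m] tail_pos[of "Suc m"] by linarith+
  then have "d \<in> C" using connected_contains_Icc[OF C(2,3) c(1)] by auto
  moreover have "d \<notin> achievement_set x"
    using gap_near_zero[OF dec _ d, of 0] by (simp add: achievement_set_eq)
  ultimately show False using C(1) by blast
qed

end

section \<open>The Guthrie-Nymann Cantorval\<close>

lemma guthrie_nymann_even: "guthrie_nymann (2 * n) = 3 / 4 ^ Suc n"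
  and guthrie_nymann_odd: "guthrie_nymann (Suc (2 * n)) = 2 / 4 ^ Suc n"
  by (simp_all add: guthrie_nymann_def)

lemma guthrie_nymann_pos: "0 < guthrie_nymann k"
  by (simp add: guthrie_nymann_def)

lemma sum_guthrie_nymann: "sum guthrie_nymann {..<2 * n} = 5 / 3 * (1 - 1 / 4 ^ n)"
proof (induction n)
  case (Suc n)
  have "sum guthrie_nymann {..<2 * Suc n} = sum guthrie_nymann {..<2 * n} + 5 / 4 ^ Suc n"
    using guthrie_nymann_even[of n] guthrie_nymann_odd[of n] by (simp add: field_simps)
  then show ?case using Suc by (simp add: field_simps)
qed simp

lemma sum_guthrie_nymann_le: "sum guthrie_nymann {..<n} \<le> 5 / 3"
proof -
  have "sum guthrie_nymann {..<n} \<le> sum guthrie_nymann {..<2 * n}"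
    by (intro sum_mono2) (auto simp: guthrie_nymann_pos less_imp_le)
  also have "\<dots> \<le> 5 / 3" unfolding sum_guthrie_nymann by simp
  finally show ?thesis .
qed

lemma summable_guthrie_nymann: "summable guthrie_nymann"
  using guthrie_nymann_pos sum_guthrie_nymann_le
  by (intro summableI_nonneg_bounded[of _ "5 / 3"]) (auto simp: less_imp_le)

lemma decseq_guthrie_nymann: "decseq guthrie_nymann"
proof (rule decseq_SucI)
  fix k
  show "guthrie_nymann (Suc k) \<le> guthrie_nymann k"
  proof (cases "even k")
    case True
    then obtain n where "k = 2 * n" by (elim evenE)
    then show ?thesis using guthrie_nymann_even[of n] guthrie_nymann_odd[of n] by (simp only: divide_le_cancel) simp
  next
    case False
    then obtain n where "k = Suc (2 * n)" using oddE[OF False] by fastforce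
    moreover have "3 / (4::real) ^ Suc (Suc n) \<le> 2 / 4 ^ Suc n" by (simp add: field_simps)
    ultimately show ?thesis using guthrie_nymann_even[of "Suc n"] guthrie_nymann_odd[of n] by simp
  qed
qed

interpretation GN: positive_summable guthrie_nymann
  by unfold_locales (auto intro: guthrie_nymann_pos summable_guthrie_nymann)

lemma guthrie_nymann_gaps: "\<exists>\<^sub>\<infinity>n. GN.tail (Suc n) < guthrie_nymann n"
  unfolding INFM_nat_le
proof (intro allI exI conjI)
  fix m
  show "m \<le> Suc (2 * m)" by simp
  have "suminf guthrie_nymann \<le> 5 / 3"
    by (rule suminf_le_const[OF summable_guthrie_nymann sum_guthrie_nymann_le])
  then have "GN.tail (2 * Suc m) \<le> 5 / 3 / 4 ^ Suc m"
    unfolding GN.tail_eq_diff sum_guthrie_nymann by (simp add: algebra_simps)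
  also have "\<dots> < guthrie_nymann (Suc (2 * m))"
    unfolding guthrie_nymann_odd by (intro divide_strict_right_mono) auto
  finally show "GN.tail (Suc (Suc (2 * m))) < guthrie_nymann (Suc (2 * m))" by simp
qed

text \<open>The sums of the first \<open>2 * n\<close> terms are the numbers \<open>m / 4 ^ n\<close> where \<open>m\<close> has a base \<open>4\<close> expansion
  of length \<open>n\<close> with digits \<open>0\<close>, \<open>2\<close>, \<open>3\<close>, \<open>5\<close>. These digits form a complete residue system modulo
  \<open>4\<close>, so the last digit can be split off; the range \<open>2 * (4 ^ n - 1) / 3 \<le> m \<le> 4 ^ n - 1\<close> is stable
  under this step.\<close>

lemma guthrie_nymann_finite_subsums:
  fixes m :: int
  assumes "2 * (4 ^ n - 1) \<le> 3 * m" "m \<le> 4 ^ n - 1"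
  shows "\<exists>A\<subseteq>{..<2 * n}. sum guthrie_nymann A = m / 4 ^ n"
  using assms
proof (induction n arbitrary: m)
  case 0
  then show ?case by (intro exI[of _ "{}"]) auto
next
  case (Suc n)
  define P :: int where "P = 4 ^ n"
  have b: "2 * (4 * P - 1) \<le> 3 * m" "m \<le> 4 * P - 1" using Suc.prems by (simp_all add: P_def)
  \<comment> \<open>Needed for the lower bound when the last digit is \<open>5\<close>.\<close>
  have "P mod 3 = 1" unfolding P_def by (induction n) (auto simp: mod_mult_right_eq[symmetric])
  then obtain R where R: "P = 3 * R + 1" by (metis mult_div_mod_eq)
  have "m mod 4 = 0 \<or> m mod 4 = 1 \<or> m mod 4 = 2 \<or> m mod 4 = 3" by presburger
  moreover have "m = 4 * (m div 4) + m mod 4" by simp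
  ultimately have "\<exists>k d. m = 4 * k + d \<and> 2 * (P - 1) \<le> 3 * k \<and> k \<le> P - 1 \<and> d \<in> {0, 2, 3, 5}"
  proof (elim disjE)
    assume r: "m mod 4 = 0" "m = 4 * (m div 4) + m mod 4"
    show ?thesis using b r by - (rule exI[of _ "m div 4"], rule exI[of _ 0], simp)
  next
    assume r: "m mod 4 = 1" "m = 4 * (m div 4) + m mod 4"
    show ?thesis using b r R by - (rule exI[of _ "m div 4 - 1"], rule exI[of _ 5], simp, presburger)
  next
    assume r: "m mod 4 = 2" "m = 4 * (m div 4) + m mod 4"
    show ?thesis using b r by - (rule exI[of _ "m div 4"], rule exI[of _ 2], simp)
  next
    assume r: "m mod 4 = 3" "m = 4 * (m div 4) + m mod 4"
    show ?thesis using b r by - (rule exI[of _ "m div 4"], rule exI[of _ 3], simp)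
  qed
  then obtain k d where kd: "m = 4 * k + d" "2 * (P - 1) \<le> 3 * k" "k \<le> P - 1" "d \<in> {0, 2, 3, 5}"
    by blast
  obtain A where A: "A \<subseteq> {..<2 * n}" "sum guthrie_nymann A = k / 4 ^ n"
    using Suc.IH[of k] kd by (auto simp: P_def)
  let ?g = "guthrie_nymann"
  have g: "?g (2 * n) = 3 / 4 ^ Suc n" "?g (Suc (2 * n)) = 2 / 4 ^ Suc n"
    by (rule guthrie_nymann_even guthrie_nymann_odd)+
  obtain D where D: "D \<subseteq> {2 * n, Suc (2 * n)}" "sum ?g D = d / 4 ^ Suc n"
  proof -
    consider "d = 0" | "d = 2" | "d = 3" | "d = 5" using kd(4) by blast
    then show thesis
    proof cases
      case 1 then show ?thesis using that[of "{}"] by simp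
    next
      case 2 then show ?thesis using that[of "{Suc (2 * n)}"] g by simp
    next
      case 3 then show ?thesis using that[of "{2 * n}"] g by simp
    next
      case 4 then show ?thesis using that[of "{2 * n, Suc (2 * n)}"] g by (simp add: field_simps)
    qed
  qed
  have "{..<2 * n} \<inter> {2 * n, Suc (2 * n)} = {}" by auto
  then have "A \<inter> D = {}" using A(1) D(1) by blast
  moreover have "finite A" "finite D" using A(1) D(1) by (auto intro: finite_subset)
  ultimately have "sum ?g (A \<union> D) = k / 4 ^ n + d / 4 ^ Suc n"
    using A D by (simp add: sum.union_disjoint)
  also have "\<dots> = m / 4 ^ Suc n" using kd(1) by (simp add: field_simps)
  finally show ?case using A D by (intro exI[of _ "A \<union> D"]) force
qed

lemma interval_subset_guthrie_nymann: "{2/3..<1} \<subseteq> achievement_set guthrie_nymann"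
proof
  fix t :: real assume t: "t \<in> {2/3..<1}"
  have "t \<in> closure (achievement_set guthrie_nymann)"
    unfolding closure_approachable
  proof (intro allI impI)
    fix e :: real assume "0 < e"
    then obtain n where n: "(1 / 4) ^ n < e"
      using real_arch_pow_inv[of e "1 / 4"] by auto
    define m where "m = \<lfloor>t * 4 ^ n\<rfloor>"
    have m: "m \<le> t * 4 ^ n" "t * 4 ^ n < m + 1" unfolding m_def by linarith+
    have "t * 4 ^ n < 4 ^ n" "2 / 3 * 4 ^ n \<le> t * 4 ^ n" using t by auto
    then have "real_of_int m < 4 ^ n" "2 * 4 ^ n < 3 * real_of_int m + 3" using m by linarith+
    then have "real_of_int m < real_of_int (4 ^ n)" "real_of_int (2 * 4 ^ n) < real_of_int (3 * m + 3)" by simp_all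
    then have "m < 4 ^ n" "2 * 4 ^ n < 3 * m + 3" by (simp_all only: of_int_less_iff)
    then obtain A where A: "A \<subseteq> {..<2 * n}" "sum guthrie_nymann A = m / 4 ^ n"
      using guthrie_nymann_finite_subsums[of n m] by auto
    have "sum guthrie_nymann A \<in> achievement_set guthrie_nymann"
      using GN.finite_subsums_subset[of "2 * n"] A(1) unfolding GN.finite_subsums_def by blast
    moreover have "dist (sum guthrie_nymann A) t < e"
    proof -
      have "\<bar>m / 4 ^ n - t\<bar> = \<bar>m - t * 4 ^ n\<bar> / 4 ^ n" by (simp add: field_simps abs_divide)
      also have "\<dots> \<le> 1 / 4 ^ n" using m by (intro divide_right_mono) auto
      finally show ?thesis using n A(2) by (simp add: dist_real_def power_divide)
    qed
    ultimately show "\<exists>y\<in>achievement_set guthrie_nymann. dist y t < e" by blast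
  qed
  then show "t \<in> achievement_set guthrie_nymann"
    using GN.compact_achievement_set by (simp add: compact_imp_closed)
qed

text \<open>Under a homeomorphism onto the achievement set, the interval \<open>[2/3, 1)\<close> becomes a nondegenerate
  connected set, and the singleton component of \<open>0\<close> becomes a singleton component.\<close>

lemma (in positive_summable) cantorval_achievement_setD:
  assumes "cantorval (achievement_set x)"
  shows "interior (achievement_set x) \<noteq> {}" and "\<exists>\<^sub>\<infinity>n. tail (Suc n) < x n"
proof -
  let ?E = "achievement_set x" and ?G = "achievement_set guthrie_nymann"
  obtain h k where "homeomorphism ?G ?E h k"
    using assms homeomorphic_sym unfolding cantorval_def homeomorphic_def by metis
  then have h: "continuous_on ?G h" "h ` ?G = ?E" "continuous_on ?E k" "k ` ?E = ?G"
    and hk: "\<And>u. u \<in> ?G \<Longrightarrow> k (h u) = u" "\<And>v. v \<in> ?E \<Longrightarrow> h (k v) = v"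
    by (auto simp: homeomorphism_def)
  have "\<exists>a b. a < b \<and> {a..b} \<subseteq> ?E"
  proof -
    have C: "connected (h ` {2/3..<1})"
      using interval_subset_guthrie_nymann h(1) by (intro connected_continuous_image) (auto intro: continuous_on_subset)
    have in_G: "2/3 \<in> ?G" "5/6 \<in> ?G" using interval_subset_guthrie_nymann by auto
    then have "h (2/3) \<noteq> h (5/6)" using hk(1)[of "2/3"] hk(1)[of "5/6"] by auto
    moreover have "h (2/3) \<in> h ` {2/3..<1}" "h (5/6) \<in> h ` {2/3..<1}" by auto
    moreover have "h ` {2/3..<1} \<subseteq> ?E" using interval_subset_guthrie_nymann h(2) by blast
    ultimately show ?thesis
      using connected_contains_Icc[OF C] by (meson linorder_neqE_linordered_idom order_trans)
  qed
  then obtain a b where "a < b" "{a..b} \<subseteq> ?E" by blast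
  then have "{a<..<b} \<subseteq> interior ?E" by (intro interior_maximal) auto
  then show "interior ?E \<noteq> {}" using \<open>a < b\<close> dense[of a b] by auto
  have 0: "0 \<in> ?G" unfolding achievement_set_def by (auto intro: image_eqI[of _ _ "{}"])
  show "\<exists>\<^sub>\<infinity>n. tail (Suc n) < x n"
  proof (rule infinitely_many_gaps_if_singleton_component)
    show "h 0 \<in> ?E" using 0 h(2) by blast
    fix C assume C: "C \<subseteq> ?E" "connected C" "h 0 \<in> C"
    have "connected (k ` C)" using C h(3) by (intro connected_continuous_image) (auto intro: continuous_on_subset)
    moreover have "k ` C \<subseteq> ?G" using C h(4) by blast
    moreover have "0 \<in> k ` C" using C(3) hk(1)[OF 0] by force
    ultimately have "k ` C = {0}"
      using GN.singleton_component_0[OF decseq_guthrie_nymann guthrie_nymann_gaps] by blast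
    then have "v = h 0" if "v \<in> C" for v
      using hk(2)[of v] that C(1) by (metis image_eqI singletonD subsetD)
    then show "C = {h 0}" using C(3) by blast
  qed
qed

lemma cantorval_like_guthrie_nymann: "cantorval_like (achievement_set guthrie_nymann)"
proof -
  have "{2/3<..<1} \<subseteq> interior (achievement_set guthrie_nymann)"
    using interval_subset_guthrie_nymann by (intro interior_maximal) auto
  then have "interior (achievement_set guthrie_nymann) \<noteq> {}"
    using dense[of "2/3" "1::real"] by auto
  then show ?thesis
    using GN.cantorval_like_achievement_set decseq_guthrie_nymann guthrie_nymann_gaps by blast
qed

section \<open>Repeating terms of a sequence\<close>

text \<open>When the terms with index in \<open>M\<close> are repeated, \<open>slot M n\<close> is the position of the first copy of the
  \<open>n\<close>-th term; the second copy, if any, immediately follows.\<close>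

definition slot :: "nat set \<Rightarrow> nat \<Rightarrow> nat" where
  "slot M n = n + card (M \<inter> {..<n})"

text \<open>The index of the original term that stands at position \<open>k\<close>.\<close>

definition unslot :: "nat set \<Rightarrow> nat \<Rightarrow> nat" where
  "unslot M k = (LEAST n. k < slot M (Suc n))"

lemma slot_Suc: "slot M (Suc n) = slot M n + (if n \<in> M then 2 else 1)"
  by (auto simp: slot_def lessThan_Suc Int_insert_right)

lemma strict_mono_slot: "strict_mono (slot M)"
  by (rule strict_monoI_Suc) (simp add: slot_Suc)

lemma unslot_eq:
  assumes "slot M n \<le> k" "k < slot M (Suc n)"
  shows "unslot M k = n"
  unfolding unslot_def
proof (rule Least_equality)
  fix n' assume "k < slot M (Suc n')"
  then have "slot M n < slot M (Suc n')" using assms(1) by simp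
  then show "n \<le> n'" using strict_mono_less[OF strict_mono_slot] by fastforce
qed (rule assms(2))

lemma unslot_bounds: "slot M (unslot M k) \<le> k" "k < slot M (Suc (unslot M k))"
proof -
  have "k < slot M (Suc k)" by (simp add: slot_def)
  then show up: "k < slot M (Suc (unslot M k))" unfolding unslot_def by (rule LeastI)
  show "slot M (unslot M k) \<le> k"
  proof (cases "unslot M k")
    case 0
    then show ?thesis by (simp add: slot_def)
  next
    case (Suc n)
    then have "\<not> k < slot M (Suc n)" unfolding unslot_def by (intro not_less_Least) simp
    then show ?thesis using Suc by simp
  qed
qed

lemma mono_unslot: "mono (unslot M)"
proof (rule monoI)
  fix k k' :: nat assume "k \<le> k'"
  then have "slot M (unslot M k) < slot M (Suc (unslot M k'))"
    using unslot_bounds(1)[where k = k] unslot_bounds(2)[where k = k'] by (meson order.strict_trans1 order_trans)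
  then show "unslot M k \<le> unslot M k'" using strict_mono_less[OF strict_mono_slot] by fastforce
qed

lemma unslot_slot: "unslot M (slot M n) = n"
  by (rule unslot_eq) (auto simp: slot_Suc)

lemma unslot_Suc_slot: "n \<in> M \<Longrightarrow> unslot M (Suc (slot M n)) = n"
  by (rule unslot_eq) (auto simp: slot_Suc)

lemma slots_cover: "{slot M n..} = slot M ` {n..} \<union> (\<lambda>i. Suc (slot M i)) ` (M \<inter> {n..})"
proof
  show "{slot M n..} \<subseteq> slot M ` {n..} \<union> (\<lambda>i. Suc (slot M i)) ` (M \<inter> {n..})"
  proof
    fix k assume "k \<in> {slot M n..}"
    then have le: "n \<le> unslot M k" using monoD[OF mono_unslot[of M], of "slot M n" k] by (simp add: unslot_slot)
    show "k \<in> slot M ` {n..} \<union> (\<lambda>i. Suc (slot M i)) ` (M \<inter> {n..})"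
    proof (cases "k = slot M (unslot M k)")
      case True
      then show ?thesis using le by auto
    next
      case False
      then have "unslot M k \<in> M" "k = Suc (slot M (unslot M k))"
        using unslot_bounds[where M = M and k = k] unfolding slot_Suc by (auto split: if_splits)
      then show ?thesis using le by auto
    qed
  qed
  show "slot M ` {n..} \<union> (\<lambda>i. Suc (slot M i)) ` (M \<inter> {n..}) \<subseteq> {slot M n..}"
    using strict_mono_less_eq[OF strict_mono_slot, of M] by (auto intro: le_SucI)
qed

lemma slots_disjoint: "slot M ` A \<inter> (\<lambda>i. Suc (slot M i)) ` (M \<inter> B) = {}"
proof -
  have "slot M a \<noteq> Suc (slot M b)" if "b \<in> M" for a b
  proof
    assume eq: "slot M a = Suc (slot M b)"
    then have "a = b" using unslot_slot unslot_Suc_slot[OF that] by metis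
    then show False using eq by simp
  qed
  then show ?thesis by blast
qed

lemma inj_slot: "inj_on (slot M) A" "inj_on (\<lambda>i. Suc (slot M i)) A"
  using strict_mono_eq[OF strict_mono_slot, of M] by (auto simp: inj_on_def)

context positive_summable
begin

text \<open>The sequence \<open>x\<close> in which every term with index in \<open>M\<close> is repeated once.\<close>

definition dup :: "nat set \<Rightarrow> nat \<Rightarrow> real" where
  "dup M k = x (unslot M k)"

lemma decseq_dup: "decseq x \<Longrightarrow> decseq (dup M)"
  unfolding dup_def using mono_unslot by (auto simp: decseq_def mono_def)

lemma infsum_dup_slot: "infsum (dup M) (slot M ` A) = infsum x A"
  by (subst infsum_reindex[OF inj_slot(1)]) (simp add: dup_def[abs_def] o_def unslot_slot)

lemma infsum_dup_Suc_slot: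
  assumes "A \<subseteq> M"
  shows "infsum (dup M) ((\<lambda>i. Suc (slot M i)) ` A) = infsum x A"
proof (subst infsum_reindex[OF inj_slot(2)], rule infsum_cong)
  fix i assume "i \<in> A"
  then have "i \<in> M" using assms by blast
  then show "(dup M \<circ> (\<lambda>i. Suc (slot M i))) i = x i" by (simp add: dup_def unslot_Suc_slot)
qed

lemma summable_dup: "summable (dup M)"
proof -
  have 1: "dup M summable_on slot M ` UNIV"
    unfolding summable_on_reindex[OF inj_slot(1)]
    using summable_on[of UNIV] by (simp add: dup_def[abs_def] o_def unslot_slot)
  have "x summable_on M \<longleftrightarrow> (dup M \<circ> (\<lambda>i. Suc (slot M i))) summable_on M"
    by (intro summable_on_cong) (simp add: dup_def unslot_Suc_slot)
  then have 2: "dup M summable_on (\<lambda>i. Suc (slot M i)) ` M"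
    unfolding summable_on_reindex[OF inj_slot(2)] using summable_on by blast
  have "slot M ` UNIV \<union> (\<lambda>i. Suc (slot M i)) ` M = UNIV"
    using slots_cover[of M 0] by (simp add: slot_def[of M 0])
  moreover have "dup M summable_on (slot M ` UNIV \<union> (\<lambda>i. Suc (slot M i)) ` M)"
    using summable_on_union[OF 1 2] .
  ultimately have "dup M summable_on UNIV" by simp
  then show ?thesis by (rule summable_on_imp_summable)
qed

lemma positive_summable_dup: "positive_summable (dup M)"
proof
  show "0 < dup M k" for k by (simp add: dup_def pos)
qed (rule summable_dup)

lemma achievement_set_dup: "achievement_set x \<subseteq> achievement_set (dup M)"
  unfolding achievement_set_def using infsum_dup_slot[of M] by (metis image_subsetI rangeI)

lemma tail_dup: "positive_summable.tail (dup M) (slot M n) = tail n + infsum x (M \<inter> {n..})"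
proof -
  interpret D: positive_summable "dup M" by (rule positive_summable_dup)
  show ?thesis
    unfolding D.tail_def tail_def slots_cover
    by (subst D.infsum_disjoint[OF slots_disjoint]) (simp add: infsum_dup_slot infsum_dup_Suc_slot)
qed

lemma gap_dup:
  assumes "n \<in> M" "tail (Suc n) + infsum x (M \<inter> {Suc n..}) < x n"
  shows "positive_summable.tail (dup M) (Suc (Suc (slot M n))) < dup M (Suc (slot M n))"
  using assms tail_dup[of M "Suc n"] by (simp add: slot_Suc dup_def unslot_Suc_slot)

text \<open>For each \<open>B \<subseteq> M\<close> the total over \<open>M\<close> arises by taking first copies for indices in \<open>B\<close> and second
  copies for the others.\<close>

lemma continuum_point_dup:
  assumes "infinite M"
  shows "continuum_point (dup M) (infsum x M)"
proof -
  interpret D: positive_summable "dup M" by (rule positive_summable_dup)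
  define rep where "rep B = slot M ` B \<union> (\<lambda>i. Suc (slot M i)) ` (M \<inter> (M - B))" for B
  have rep: "infsum (dup M) (rep B) = infsum x M" if "B \<subseteq> M" for B
  proof -
    have "infsum (dup M) (rep B) = infsum x B + infsum x (M \<inter> (M - B))"
      unfolding rep_def by (subst D.infsum_disjoint[OF slots_disjoint]) (simp add: infsum_dup_slot infsum_dup_Suc_slot)
    also have "\<dots> = infsum x (B \<union> (M \<inter> (M - B)))"
      by (rule infsum_disjoint[symmetric]) auto
    also have "B \<union> (M \<inter> (M - B)) = M" using that by auto
    finally show ?thesis .
  qed
  have slot_rep: "B = {n. slot M n \<in> rep B}" for B
  proof -
    have "slot M n \<in> rep B \<longleftrightarrow> n \<in> B" for n
    proof -
      have "slot M n \<notin> (\<lambda>i. Suc (slot M i)) ` (M \<inter> (M - B))"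
        using slots_disjoint[of M UNIV "M - B"] by blast
      then show ?thesis unfolding rep_def using inj_image_mem_iff[OF inj_slot(1)] by blast
    qed
    then show ?thesis by simp
  qed
  let ?R = "{A. infsum (dup M) A = infsum x M}"
  have "(UNIV :: nat set set) \<lesssim> ?R"
    unfolding lepoll_def
  proof (intro exI conjI)
    let ?f = "\<lambda>D. rep (enumerate M ` D)"
    have "inj (enumerate M)" using strict_mono_enumerate[OF assms] strict_mono_imp_inj_on by blast
    moreover have "enumerate M ` D = enumerate M ` D'" if "?f D = ?f D'" for D D'
      using slot_rep[of "enumerate M ` D"] slot_rep[of "enumerate M ` D'"] that by simp
    ultimately show "inj ?f" by (metis (no_types, lifting) inj_def inj_image_eq_iff)
    show "range ?f \<subseteq> ?R" using rep enumerate_in_set[OF assms] by blast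
  qed
  moreover have "?R \<lesssim> (UNIV :: nat set set)" by (rule subset_imp_lepoll) simp
  ultimately have "?R \<approx> (UNIV :: nat set set)" by (rule lepoll_antisym[rotated])
  then have "?R \<approx> (UNIV :: real set)" using nat_sets_eqpoll_reals eqpoll_trans by blast
  moreover have "infsum x M \<in> achievement_set (dup M)"
    unfolding achievement_set_def using rep[of "{}"] by (metis empty_subsetI rangeI)
  ultimately show ?thesis unfolding continuum_point_def by blast
qed

text \<open>Enumerate \<open>M\<close> by \<open>\<nu>\<close>, where \<open>\<delta> n\<close> is the surplus of \<open>x n\<close> over the later terms. Each chosen
  term is at most a quarter of the preceding surplus, which in turn is at most the preceding chosen
  term. So the chosen terms after \<open>\<nu> j\<close> add up to at most a third of \<open>\<delta> (\<nu> j)\<close>.\<close>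

lemma ex_sparse_gaps:
  assumes inf: "\<exists>\<^sub>\<infinity>n. tail (Suc n) < x n"
  obtains M where "infinite M" "\<And>n. n \<in> M \<Longrightarrow> tail (Suc n) + infsum x (M \<inter> {Suc n..}) < x n"
proof -
  define \<delta> where "\<delta> n = x n - tail (Suc n)" for n
  have "\<exists>\<nu>. \<forall>j. 0 < \<delta> (\<nu> j) \<and> (\<nu> j < \<nu> (Suc j) \<and> x (\<nu> (Suc j)) \<le> \<delta> (\<nu> j) / 4)"
  proof (rule dependent_nat_choice)
    show "\<exists>n. 0 < \<delta> n" using inf unfolding INFM_nat \<delta>_def by auto
    fix n assume "0 < \<delta> n"
    then obtain N where N: "tail N < \<delta> n / 4" using ex_tail_less[of "\<delta> n / 4" 0] by auto
    obtain m where m: "max N (Suc n) \<le> m" "tail (Suc m) < x m"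
      using inf unfolding INFM_nat_le by blast
    have "x m \<le> infsum x {N..}" by (rule infsum_mem_le) (use m in auto)
    then have "x m \<le> \<delta> n / 4" using N unfolding tail_def by linarith
    then show "\<exists>m. 0 < \<delta> m \<and> (n < m \<and> x m \<le> \<delta> n / 4)"
      using m unfolding \<delta>_def by (intro exI[of _ m]) auto
  qed
  then obtain \<nu> where \<nu>: "\<And>j. 0 < \<delta> (\<nu> j)" "\<And>j. \<nu> j < \<nu> (Suc j)" "\<And>j. x (\<nu> (Suc j)) \<le> \<delta> (\<nu> j) / 4"
    by blast
  have sm: "strict_mono \<nu>" using \<nu>(2) by (rule strict_monoI_Suc)
  have geometric: "x (\<nu> (Suc j + i)) \<le> \<delta> (\<nu> j) / 4 * (1 / 4) ^ i" for j i
  proof (induction i)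
    case (Suc i)
    have "\<delta> (\<nu> (Suc j + i)) \<le> x (\<nu> (Suc j + i))"
      unfolding \<delta>_def using tail_pos by (simp add: less_imp_le)
    then show ?case using Suc \<nu>(3)[of "Suc j + i"] by simp
  qed (use \<nu>(3) in simp)
  show thesis
  proof (rule that[of "range \<nu>"])
    show "infinite (range \<nu>)" using sm strict_mono_imp_inj_on range_inj_infinite by blast
    fix n assume "n \<in> range \<nu>"
    then obtain j where j: "n = \<nu> j" by blast
    define h where "h i = \<nu> (Suc j + i)" for i
    have "inj h" using strict_mono_eq[OF sm] unfolding h_def inj_def by auto
    have on_h: "(\<lambda>i. x (h i)) summable_on UNIV"
      using summable_on_reindex[OF \<open>inj h\<close>, of x] summable_on by (simp add: o_def)
    have "range \<nu> \<inter> {Suc n..} = range h"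
    proof
      show "range \<nu> \<inter> {Suc n..} \<subseteq> range h"
      proof
        fix k assume "k \<in> range \<nu> \<inter> {Suc n..}"
        then obtain l where l: "k = \<nu> l" "\<nu> j < \<nu> l" using j by auto
        then have "j < l" using strict_mono_less[OF sm] by blast
        then have "k = h (l - Suc j)" using l unfolding h_def by simp
        then show "k \<in> range h" by blast
      qed
      show "range h \<subseteq> range \<nu> \<inter> {Suc n..}"
        using strict_mono_less[OF sm] unfolding h_def j by (auto simp: Suc_le_eq)
    qed
    then have "infsum x (range \<nu> \<inter> {Suc n..}) = infsum (\<lambda>i. x (h i)) UNIV"
      using infsum_reindex[OF \<open>inj h\<close>, of x] by (simp add: o_def)
    also have "\<dots> = (\<Sum>i. x (h i))"
      using has_sum_imp_sums[OF has_sum_infsum[OF on_h]] by (rule sums_unique)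
    also have "\<dots> \<le> (\<Sum>i. \<delta> n / 4 * (1 / 4) ^ i)"
    proof (rule suminf_le)
      show "x (h i) \<le> \<delta> n / 4 * (1 / 4) ^ i" for i using geometric[of j i] unfolding h_def j .
      show "summable (\<lambda>i. \<delta> n / 4 * (1 / 4) ^ i)" by (intro summable_mult summable_geometric) simp
      show "summable (\<lambda>i. x (h i))" using on_h by (rule summable_on_imp_summable)
    qed
    also have "\<dots> = \<delta> n / 4 * (\<Sum>i. (1 / 4) ^ i)"
      by (intro suminf_mult summable_geometric) simp
    also have "\<dots> = \<delta> n / 3" by (simp add: suminf_geometric)
    also have "\<dots> < \<delta> n" using \<nu>(1)[of j] by (simp add: j)
    finally show "tail (Suc n) + infsum x (range \<nu> \<inter> {Suc n..}) < x n"
      by (simp add: \<delta>_def)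
  qed
qed

end

section \<open>Enlarging a Cantorval to one with a continuum point\<close>

theorem theorem6p4:
  fixes y :: "nat \<Rightarrow> real"
  assumes "decseq y"
    and "\<And>n. y n > 0"
    and "summable y"
    and "cantorval (achievement_set y)"
  shows "\<exists>x :: nat \<Rightarrow> real.
    decseq x \<and> (\<forall>n. x n > 0) \<and> summable x \<and>
    cantorval (achievement_set x) \<and>
    achievement_set y \<subseteq> achievement_set x \<and>
    (\<exists>t. continuum_point x t)"
proof -
  interpret Y: positive_summable y using assms by unfold_locales
  obtain M where M: "infinite M" "\<And>n. n \<in> M \<Longrightarrow> Y.tail (Suc n) + infsum y (M \<inter> {Suc n..}) < y n"
    using Y.ex_sparse_gaps Y.cantorval_achievement_setD(2)[OF assms(4)] by blast
  interpret X: positive_summable "Y.dup M" by (rule Y.positive_summable_dup)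
  have dec: "decseq (Y.dup M)" by (rule Y.decseq_dup) fact
  have sub: "achievement_set y \<subseteq> achievement_set (Y.dup M)" by (rule Y.achievement_set_dup)
  have "\<exists>\<^sub>\<infinity>k. X.tail (Suc k) < Y.dup M k"
    unfolding INFM_nat_le
  proof
    fix m
    obtain n where n: "n \<in> M" "m \<le> n" using M(1) infinite_nat_iff_unbounded_le by blast
    have "m \<le> Suc (slot M n)" using n(2) by (simp add: slot_def)
    then show "\<exists>k\<ge>m. X.tail (Suc k) < Y.dup M k"
      using Y.gap_dup[OF n(1) M(2)[OF n(1)]] by blast
  qed
  moreover have "interior (achievement_set (Y.dup M)) \<noteq> {}"
    using Y.cantorval_achievement_setD(1)[OF assms(4)] interior_mono[OF sub] by blast
  ultimately have "cantorval_like (achievement_set (Y.dup M))"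
    using X.cantorval_like_achievement_set dec by blast
  then have "cantorval (achievement_set (Y.dup M))"
    unfolding cantorval_def by (rule cantorval_like_homeomorphic[OF _ cantorval_like_guthrie_nymann])
  then show ?thesis
    using dec X.pos X.summable sub Y.continuum_point_dup[OF M(1)] by blast
qed

end
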